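(* Let $0\le m\le m'\le n$ and let $W=(w_{pq})$ be a real $n\times m'$ matrix ($p\in[n]$, $q\in[m']$). Then the function $f_w$ on $C_m^{m'}=\{S\subseteq[n]:m\le|S|\le m'\}$ defined by $f_w(S):=\max\{w(\mathcal F)\}$, the maximum over all admissible flows $\mathcal F$ in $\Gamma_{n,m'}$ for $S$, is a TP-function on $C_m^{m'}$.
   Context: The grid $\Gamma_{n,m'}$ is the directed graph with vertices $v_{pq}$ ($p\in[n]$, $q\in[m']$) and edges $(v_{pq},v_{p-1,q})$ (for $p\ge2$) and $(v_{pq},v_{p,q+1})$ (for $q<m'$). Sources: $s_p:=v_{p1}$; sinks: $t_q:=v_{1q}$. A flow is a collection $\mathcal F$ of directed paths in $\Gamma_{n,m'}$ each starting at a source and ending at a sink (a single vertex $s_1=t_1$ counts as a path); $\mathcal F$ is admissible if its paths are pairwise vertex-disjoint and the sinks reached are exactly $t_1,\dots,t_{|\mathcal F|}$. $\mathcal F$ is a flow for $S$ if its set of starting vertices is $\{s_p:p\in S\}$. $w(v_{pq}):=w_{pq}$; $w(P)$ is the sum of $w$ over the vertices of a path $P$, $w(\mathcal F)=\sum_{P\in\mathcal F}w(P)$. For $X\subseteq[n]$ and elements $i,j,\dots\notin X$, $Xij\cdots:=X\cup\{i,j,\dots\}$. A function $f$ on $C_m^{m'}$ is a TP-function if $f(Xik)+f(Xj)=\max\{f(Xij)+f(Xk),f(Xi)+f(Xjk)\}$ for all $i<j<k$, $X\subseteq[n]\setminus\{i,j,k\}$ with all six sets in $C_m^{m'}$, and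 $f(Xik)+f(Xj\ell)=\max\{f(Xij)+f(Xk\ell),f(Xi\ell)+f(Xjk)\}$ for all $i<j<k<\ell$, $X\subseteq[n]\setminus\{i,j,k,\ell\}$ with all six sets in $C_m^{m'}$. *)

theory Defs
  imports Complex_Main "Graph_Theory.Vertex_Walk"
begin

definition grid :: "nat \<Rightarrow> nat \<Rightarrow> (nat \<times> nat, (nat \<times> nat) \<times> (nat \<times> nat)) pre_digraph" where
  "grid n m' = \<lparr>
     verts = {1..n} \<times> {1..m'},
     arcs = {((p, q), (p - 1, q)) | p q. p \<in> {2..n} \<and> q \<in> {1..m'}}
          \<union> {((p, q), (p, q + 1)) | p q. p \<in> {1..n} \<and> q \<in> {1..<m'}},
     tail = fst,
     head = snd \<rparr>"

definition source :: "nat \<Rightarrow> nat \<times> nat" where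
  "source p = (p, 1)"

definition sink :: "nat \<Rightarrow> nat \<times> nat" where
  "sink q = (1, q)"

text \<open>
  A path is the nonempty list of its vertices. Flows are sets of paths: a repeated path would
  violate vertex-disjointness, so multiplicities are irrelevant for admissible flows.
\<close>

definition flow :: "nat \<Rightarrow> nat \<Rightarrow> (nat \<times> nat) list set \<Rightarrow> bool" where
  "flow n m' F \<longleftrightarrow>
     (\<forall>P\<in>F. vpath P (grid n m') \<and> hd P \<in> source ` {1..n} \<and> last P \<in> sink ` {1..m'})"

definition admissible :: "nat \<Rightarrow> nat \<Rightarrow> (nat \<times> nat) list set \<Rightarrow> bool" where
  "admissible n m' F \<longleftrightarrow>
     flow n m' F \<and> pairwise (\<lambda>P Q. disjnt (set P) (set Q)) F \<and> last ` F = sink ` {1..card F}"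

definition admissible_flows_for :: "nat \<Rightarrow> nat \<Rightarrow> nat set \<Rightarrow> (nat \<times> nat) list set set" where
  "admissible_flows_for n m' S = {F. admissible n m' F \<and> hd ` F = source ` S}"

text \<open>The matrix entry \<open>w p q\<close> is used only for \<open>p \<in> {1..n}\<close> and \<open>q \<in> {1..m'}\<close>.\<close>

definition path_weight :: "(nat \<Rightarrow> nat \<Rightarrow> real) \<Rightarrow> (nat \<times> nat) list \<Rightarrow> real" where
  "path_weight w P = (\<Sum>(p, q)\<in>set P. w p q)"

definition flow_weight :: "(nat \<Rightarrow> nat \<Rightarrow> real) \<Rightarrow> (nat \<times> nat) list set \<Rightarrow> real" where
  "flow_weight w F = (\<Sum>P\<in>F. path_weight w P)"

definition max_flow_weight :: "nat \<Rightarrow> nat \<Rightarrow> (nat \<Rightarrow> nat \<Rightarrow> real) \<Rightarrow> nat set \<Rightarrow> real" where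
  "max_flow_weight n m' w S = Max (flow_weight w ` admissible_flows_for n m' S)"

definition truncated_cube :: "nat \<Rightarrow> nat \<Rightarrow> nat \<Rightarrow> nat set set" where
  "truncated_cube n m m' = {S. S \<subseteq> {1..n} \<and> m \<le> card S \<and> card S \<le> m'}"

definition TP_function :: "nat \<Rightarrow> nat \<Rightarrow> nat \<Rightarrow> (nat set \<Rightarrow> real) \<Rightarrow> bool" where
  "TP_function n m m' f \<longleftrightarrow>
     (\<forall>i j k X. i < j \<and> j < k \<and> X \<subseteq> {1..n} - {i, j, k} \<and>
        {X \<union> {i, k}, X \<union> {j}, X \<union> {i, j}, X \<union> {k}, X \<union> {i}, X \<union> {j, k}}
          \<subseteq> truncated_cube n m m' \<longrightarrow>
        f (X \<union> {i, k}) + f (X \<union> {j}) =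
          max (f (X \<union> {i, j}) + f (X \<union> {k})) (f (X \<union> {i}) + f (X \<union> {j, k}))) \<and>
     (\<forall>i j k l X. i < j \<and> j < k \<and> k < l \<and> X \<subseteq> {1..n} - {i, j, k, l} \<and>
        {X \<union> {i, k}, X \<union> {j, l}, X \<union> {i, j}, X \<union> {k, l}, X \<union> {i, l}, X \<union> {j, k}}
          \<subseteq> truncated_cube n m m' \<longrightarrow>
        f (X \<union> {i, k}) + f (X \<union> {j, l}) =
          max (f (X \<union> {i, j}) + f (X \<union> {k, l})) (f (X \<union> {i, l}) + f (X \<union> {j, k})))"

text \<open>
  The maximum in \<open>max_flow_weight\<close> is taken over a finite set, which is nonempty for every
  \<open>S\<close> in the truncated cube.
\<close>

lemma finite_admissible_flows_for: "finite (admissible_flows_for n m' S)"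
proof -
  let ?V = "verts (grid n m')"
  have "finite ?V" by (simp add: grid_def)
  then have "finite {P. set P \<subseteq> ?V \<and> distinct P}"
    by (rule finite_subset_distinct)
  moreover have "admissible_flows_for n m' S \<subseteq> Pow {P. set P \<subseteq> ?V \<and> distinct P}"
    by (auto simp: admissible_flows_for_def admissible_def flow_def vpath_def vwalk_def)
  ultimately show ?thesis
    by (meson finite_Pow_iff finite_subset)
qed

lemma vwalk_up:
  assumes "1 \<le> p" "p \<le> n" "q \<in> {1..m'}"
  shows "vwalk (map (\<lambda>a. (a, q)) (rev [1..<Suc p])) (grid n m')"
  using assms
proof (induction p)
  case 0
  then show ?case by simp
next
  case (Suc p)
  show ?case
  proof (cases "p = 0")
    case True
    then show ?thesis using Suc.prems by (auto simp: vwalk_def grid_def)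
  next
    case False
    then have "vwalk ((Suc p, q) # map (\<lambda>a. (a, q)) (rev [1..<Suc p])) (grid n m')"
      using Suc by (intro vwalk_consI) (force simp: grid_def arcs_ends_def arc_to_ends_def)+
    then show ?thesis by simp
  qed
qed

lemma vwalk_right_up:
  assumes "p \<in> {1..n}" "c \<in> {1..m'}" "d < c"
  shows "vwalk (map (\<lambda>b. (p, b)) [c - d..<c] @ map (\<lambda>a. (a, c)) (rev [1..<Suc p])) (grid n m')"
  using assms
proof (induction d)
  case 0
  then show ?case using vwalk_up[of p n c m'] by simp
next
  case (Suc d)
  let ?L = "map (\<lambda>b. (p, b)) [c - d..<c] @ map (\<lambda>a. (a, c)) (rev [1..<Suc p])"
  have hd: "hd ?L = (p, c - d)"
    using Suc.prems by (cases "d = 0") (auto simp: hd_append hd_map)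
  have "((p, c - Suc d), (p, c - d)) \<in> arcs (grid n m')"
    using Suc.prems by (auto simp: grid_def)
  then have "((p, c - Suc d), hd ?L) \<in> arcs_ends (grid n m')"
    unfolding hd by (force simp: arcs_ends_def arc_to_ends_def grid_def)
  moreover have "(p, c - Suc d) \<in> verts (grid n m')"
    using Suc.prems by (auto simp: grid_def)
  ultimately have "vwalk ((p, c - Suc d) # ?L) (grid n m')"
    using Suc by (intro vwalk_consI) auto
  moreover have "[c - Suc d..<c] = (c - Suc d) # [c - d..<c]"
    using Suc.prems by (simp add: upt_conv_Cons Suc_diff_Suc)
  ultimately show ?case by simp
qed

lemma admissible_flows_for_nonempty:
  assumes "S \<in> truncated_cube n m m'"
  shows "admissible_flows_for n m' S \<noteq> {}"
proof -
  have S: "S \<subseteq> {1..n}" "card S \<le> m'"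
    using assms by (auto simp: truncated_cube_def)
  then have fin: "finite S" by (meson finite_atLeastAtMost finite_subset)
  define c where "c x = card {y \<in> S. y \<le> x}" for x
  define L where
    "L x = map (\<lambda>b. (x, b)) [1..<c x] @ map (\<lambda>a. (a, c x)) (rev [1..<Suc x])" for x
  have c_mono: "c x < c y" if "x < y" "y \<in> S" for x y
  proof -
    have "y \<notin> {z \<in> S. z \<le> x}" "y \<in> {z \<in> S. z \<le> y}" using that by auto
    then have "{z \<in> S. z \<le> x} \<subset> {z \<in> S. z \<le> y}" using that(1) by force
    then show ?thesis unfolding c_def using fin by (intro psubset_card_mono) auto
  qed
  have c_ge: "1 \<le> c x" if "x \<in> S" for x
    using that fin by (force simp: c_def Suc_le_eq card_gt_0_iff)
  have c_le: "c x \<le> card S" for x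
    unfolding c_def using fin by (intro card_mono) auto
  have inj: "inj_on c S"
    by (rule inj_onI) (metis c_mono less_irrefl nat_neq_iff)
  have img: "c ` S = {1..card S}"
    using c_ge c_le inj by (intro card_subset_eq) (auto simp: card_image)
  have set_L: "set (L x) = {x} \<times> {1..<c x} \<union> {1..x} \<times> {c x}" for x
    by (auto simp: L_def)
  have hd_L: "hd (L x) = (x, 1)" if "x \<in> S" for x
    using c_ge[OF that] S that by (cases "c x = 1") (auto simp: L_def hd_append hd_map)
  have last_L: "last (L x) = (1, c x)" if "x \<in> S" for x
  proof -
    have "[1..<Suc x] = 1 # [2..<Suc x]"
      using that S upt_conv_Cons[of 1 "Suc x"] by (auto simp: numeral_2_eq_2)
    then show ?thesis by (simp add: L_def del: upt_Suc)
  qed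
  have vw: "vwalk (L x) (grid n m')" if "x \<in> S" for x
    using vwalk_right_up[of x n "c x" m' "c x - 1"] c_ge[OF that] c_le[of x] S that
    by (auto simp: L_def)
  have dist: "distinct (L x)" for x
    by (auto simp: L_def distinct_map inj_on_def)
  have disj: "disjnt (set (L x)) (set (L y))" if "x \<in> S" "y \<in> S" "x < y" for x y
    using c_mono[OF that(3,2)] that by (auto simp: disjnt_def set_L)
  have disj': "disjnt (set (L x)) (set (L y))" if "x \<in> S" "y \<in> S" "x \<noteq> y" for x y
    using disj that by (metis disjnt_sym nat_neq_iff)
  have inj_L: "inj_on L S"
    by (rule inj_onI) (metis hd_L fst_conv)
  have "flow n m' (L ` S)"
    unfolding flow_def vpath_def
    using vw dist hd_L last_L S(1) c_ge order_trans[OF c_le S(2)]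
    by (auto simp: source_def sink_def image_iff)
  moreover have "pairwise (\<lambda>P Q. disjnt (set P) (set Q)) (L ` S)"
    using disj' by (auto simp: pairwise_def)
  moreover have "last ` L ` S = sink ` {1..card (L ` S)}"
    unfolding card_image[OF inj_L] img[symmetric] image_image
    using last_L by (auto simp: sink_def intro!: image_cong)
  moreover have "hd ` L ` S = source ` S"
    unfolding image_image using hd_L by (auto simp: source_def intro!: image_cong)
  ultimately have "L ` S \<in> admissible_flows_for n m' S"
    by (simp add: admissible_flows_for_def admissible_def)
  then show ?thesis by blast
qed

end

theory Submission
  imports Defs "HOL-Library.FuncSet" "Jordan_Normal_Form.Determinant"
begin

text \<open>
  Give the vertex \<open>v\<^bsub>pq\<^esub>\<close> the weight \<open>exp (t * w p q)\<close>. The generating function of the admissible flows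
  for \<open>S\<close> is then the minor, with rows \<open>S\<close> and the first \<open>|S|\<close> columns, of the matrix of path generating
  functions, and such flag minors satisfy the three-term Pluecker relations, both of which have the
  shape \<open>a b = c d + e f\<close> with positive terms. Comparing the growth of both sides as \<open>t\<close> tends to
  infinity replaces products by sums and sums by maxima.

  The determinant formula is proved without sign-reversing involutions. Let \<open>S\<close> consist of
  \<open>s\<^sub>0 < \<dots> < s\<^sub>m\<close>. By disjointness the path from \<open>s\<^sub>0\<close> climbs the first column to the sink, and the path
  from \<open>s\<^bsub>b+1\<^esub>\<close> leaves that column in some row of the gap between \<open>s\<^sub>b\<close> and \<open>s\<^bsub>b+1\<^esub>\<close>; what remains is an
  arbitrary admissible flow in a grid with one column less. The minors obey the same recursion, so
  the maximal flow weight and the growth rate of the minor agree by induction on \<open>|S|\<close>.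
\<close>

subsection \<open>Flag minors\<close>

text \<open>The columns are always the first \<open>length L\<close> ones, so only the rows vary.
  They form a list rather than a set, so that repeated rows and the signs of reorderings can be
  expressed.\<close>

definition minor :: "(nat \<Rightarrow> nat \<Rightarrow> 'a::comm_ring_1) \<Rightarrow> nat list \<Rightarrow> 'a" where
  "minor u L = det (mat (length L) (length L) (\<lambda>(a, b). u (L ! a) b))"

lemma mat_delete_rows:
  assumes "a < Suc n" "length L = Suc n" "c < Suc n"
  shows "mat_delete (mat (Suc n) (Suc n) (\<lambda>(a, b). u (L ! a) b)) a c =
    mat n n (\<lambda>(i, b). u ((take a L @ drop (Suc a) L) ! i) (if b < c then b else Suc b))"
  using assms by (auto simp: mat_delete_def nth_append intro!: cong_mat)

text \<open>Laplace expansion along the row of \<open>p\<close>. The sum on the right is free of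
  \<open>a\<close>, so the position of the new row enters only through a sign.\<close>

lemma minor_insert:
  assumes "a \<le> length L"
  shows "minor u (take a L @ p # drop a L) = (-1) ^ a *
    (\<Sum>c<Suc (length L). u p c * ((-1) ^ c *
      det (mat (length L) (length L) (\<lambda>(i, b). u (L ! i) (if b < c then b else Suc b)))))"
proof -
  let ?L = "take a L @ p # drop a L" and ?n = "length L"
  have len: "length ?L = Suc ?n" and nth: "?L ! a = p" and a: "a < Suc ?n"
    using assms by (auto simp: nth_append)
  have del: "take a ?L @ drop (Suc a) ?L = L" using assms by simp
  have "minor u ?L = (\<Sum>c<Suc ?n. u p c * ((-1) ^ (a + c) *
      det (mat ?n ?n (\<lambda>(i, b). u (L ! i) (if b < c then b else Suc b)))))"
    unfolding minor_def len
    by (subst laplace_expansion_row[OF _ a])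
       (auto simp: cofactor_def mat_delete_rows[OF a len] del nth a simp del: take_append drop_append)
  then show ?thesis by (simp add: sum_distrib_left power_add mult_ac del: sum.lessThan_Suc)
qed

lemma minor_move_front:
  assumes "a \<le> length L"
  shows "minor u (take a L @ p # drop a L) = (-1) ^ a * minor u (p # L)"
  using minor_insert[OF assms, of u p] minor_insert[of 0 L u p] by simp

lemma minor_Cons_eq_0:
  assumes "p \<in> set L"
  shows "minor u (p # L) = 0"
proof -
  obtain i where i: "i < length L" "L ! i = p" using assms by (auto simp: in_set_conv_nth)
  show ?thesis unfolding minor_def
    by (rule det_identical_rows[of _ "Suc (length L)" 0 "Suc i"]) (use i in auto)
qed

text \<open>
  The numbers \<open>minor u (p # Z)\<close>, as \<open>p\<close> varies, form a linear combination of the first columns of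
  \<open>u\<close>. Appending them as a last column gives a singular matrix, whose Laplace expansion is the
  relation below.
\<close>

lemma plucker_exchange:
  fixes u :: "nat \<Rightarrow> nat \<Rightarrow> 'a::idom"
  assumes Y: "length Y = Suc N" and Z: "length Z < N"
  shows "(\<Sum>a<Suc N. (-1) ^ a * minor u (Y ! a # Z) * minor u (take a Y @ drop (Suc a) Y)) = 0"
proof -
  define z where "z = length Z"
  define C where "C c = (-1) ^ c * det (mat z z (\<lambda>(i, b). u (Z ! i) (if b < c then b else Suc b)))" for c
  have phi: "minor u (p # Z) = (\<Sum>c<Suc z. u p c * C c)" for p
    using minor_insert[of 0 Z u p] by (simp add: C_def z_def)
  define A where "A = mat (Suc N) (Suc N) (\<lambda>(a, b). if b < N then u (Y ! a) b else minor u (Y ! a # Z))"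
  have A: "A \<in> carrier_mat (Suc N) (Suc N)" by (simp add: A_def)
  \<comment> \<open>The coefficients of the column dependence: \<open>C c\<close> on the first
    \<open>Suc z\<close> columns and -1 on the appended one. Since \<open>length Z < N\<close>, the
    index \<open>N\<close> lies outside the first block.\<close>
  define v where "v = vec (Suc N) (\<lambda>c. if c < Suc z then C c else if c = N then - 1 else 0)"
  have "A *\<^sub>v v = 0\<^sub>v (Suc N)"
  proof (rule eq_vecI)
    fix a assume a: "a < dim_vec (0\<^sub>v (Suc N) :: 'a vec)"
    have "(A *\<^sub>v v) $ a = (\<Sum>c\<in>{0..<Suc N}. A $$ (a, c) * v $ c)"
      using a A by (auto simp: scalar_prod_def v_def intro!: sum.cong)
    also have "\<dots> = (\<Sum>c\<in>{0..<N}. A $$ (a, c) * v $ c) - minor u (Y ! a # Z)"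
      using a Z by (simp add: A_def v_def z_def)
    also have "(\<Sum>c\<in>{0..<N}. A $$ (a, c) * v $ c) = (\<Sum>c<Suc z. u (Y ! a) c * C c)"
      using a Z by (intro sum.mono_neutral_cong_right) (auto simp: A_def v_def z_def)
    finally show "(A *\<^sub>v v) $ a = 0\<^sub>v (Suc N) $ a" using a by (simp add: phi)
  qed (use A in simp)
  moreover have "v \<noteq> 0\<^sub>v (Suc N)"
  proof
    assume "v = 0\<^sub>v (Suc N)"
    then have "v $ N = 0" by simp
    then show False using Z by (simp add: v_def z_def)
  qed
  moreover have "v \<in> carrier_vec (Suc N)" by (simp add: v_def)
  ultimately have 0: "det A = 0" using det_0_iff_vec_prod_zero[OF A] by blast
  have del: "mat_delete A a N = mat N N (\<lambda>(i, b). u ((take a Y @ drop (Suc a) Y) ! i) b)"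
    if "a < Suc N" for a
    using that Y by (auto simp: A_def mat_delete_def nth_append intro!: cong_mat)
  have "det A = (\<Sum>a<Suc N. minor u (Y ! a # Z) * ((-1) ^ (a + N) * minor u (take a Y @ drop (Suc a) Y)))"
    unfolding laplace_expansion_column[OF A lessI]
  proof (rule sum.cong[OF refl])
    fix a assume "a \<in> {..<Suc N}"
    then show "A $$ (a, N) * cofactor A a N =
        minor u (Y ! a # Z) * ((-1) ^ (a + N) * minor u (take a Y @ drop (Suc a) Y))"
      using Y by (simp add: cofactor_def del minor_def[of u "take a Y @ drop (Suc a) Y"])
         (simp add: A_def)
  qed
  also have "\<dots> = (-1) ^ N * (\<Sum>a<Suc N. (-1) ^ a * minor u (Y ! a # Z) * minor u (take a Y @ drop (Suc a) Y))"
    by (simp add: sum_distrib_left power_add mult_ac del: sum.lessThan_Suc)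
  finally show ?thesis using 0 by simp
qed

section \<open>Exchange relations for minors indexed by sets\<close>

definition flag_minor :: "(nat \<Rightarrow> nat \<Rightarrow> 'a::comm_ring_1) \<Rightarrow> nat set \<Rightarrow> 'a" where
  "flag_minor u S = minor u (sorted_list_of_set S)"

text \<open>For \<open>y\<close> in \<open>S\<close> this is its index in the sorted list, for
  \<open>y\<close> outside \<open>S\<close> the index at which it would be inserted. The signs below
  use both readings.\<close>

definition rank_in :: "nat set \<Rightarrow> nat \<Rightarrow> nat" where
  "rank_in S y = card {z \<in> S. z < y}"

text \<open>Cut the sorted list at \<open>y\<close>: the entries in front of \<open>y\<close> are
  exactly the smaller elements, so the rank is the length of the prefix.\<close>

lemma sorted_list_of_set_nth_rank:
  assumes "finite S" "y \<in> S"
  shows "rank_in S y < card S" "sorted_list_of_set S ! rank_in S y = y"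
    "sorted_list_of_set (S - {y}) = take (rank_in S y) (sorted_list_of_set S) @ drop (Suc (rank_in S y)) (sorted_list_of_set S)"
proof -
  let ?L = "sorted_list_of_set S"
  have sorted: "sorted_wrt (<) ?L" and set: "set ?L = S" using assms by auto
  obtain xs ys where L: "?L = xs @ y # ys" using assms set by (metis split_list)
  have "{z \<in> set ?L. z < y} = set xs"
    using sorted unfolding L by (auto simp: sorted_wrt_append)
  moreover have "distinct xs"
    using distinct_sorted_list_of_set[of S] unfolding L by simp
  ultimately have r: "rank_in S y = length xs"
    unfolding set rank_in_def by (simp add: distinct_card)
  have "card S = length ?L" by simp
  then show "rank_in S y < card S" unfolding r L by simp
  show "?L ! rank_in S y = y" unfolding r L by simp
  have "sorted_wrt (<) (xs @ ys)" using sorted unfolding L by (simp add: sorted_wrt_append)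
  then have "sorted_list_of_set (set (xs @ ys)) = xs @ ys"
    unfolding strict_sorted_iff by (intro sorted_list_of_set.idem_if_sorted_distinct) auto
  moreover have "S - {y} = set (xs @ ys)"
    using sorted arg_cong[OF L, of set] unfolding set unfolding L by (auto simp: sorted_wrt_append)
  ultimately show "sorted_list_of_set (S - {y}) = take (rank_in S y) ?L @ drop (Suc (rank_in S y)) ?L"
    unfolding r L by simp
qed

text \<open>The sorted place of \<open>y\<close> is behind the \<open>rank_in Z y\<close> smaller
  rows of \<open>Z\<close>. Moving the front row there costs one sign for each of them.\<close>

lemma minor_Cons_flag:
  assumes "finite Z" "y \<notin> Z"
  shows "minor u (y # sorted_list_of_set Z) = (-1) ^ rank_in Z y * flag_minor u (insert y Z)"
proof -
  let ?Y = "insert y Z" and ?M = "sorted_list_of_set Z"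
  let ?L = "sorted_list_of_set (insert y Z)"
  have r: "rank_in ?Y y = rank_in Z y"
    unfolding rank_in_def by (rule arg_cong[of _ _ card]) auto
  let ?r = "rank_in Z y"
  have Y: "finite ?Y" "y \<in> ?Y" "?Y - {y} = Z" using assms by auto
  note * = sorted_list_of_set_nth_rank[OF Y(1,2), unfolded r Y(3), folded length_sorted_list_of_set]
  have tk: "take ?r ?M = take ?r ?L" "drop ?r ?M = drop (Suc ?r) ?L"
    using *(1) unfolding *(3) by (simp_all add: min_def)
  have L: "?L = take ?r ?M @ y # drop ?r ?M"
    using id_take_nth_drop[OF *(1)] unfolding tk *(2) .
  have "?r \<le> length ?M" using assms(1)
    by (auto simp: rank_in_def intro: card_mono)
  then have "flag_minor u ?Y = (-1) ^ ?r * minor u (y # ?M)"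
    unfolding flag_minor_def L by (rule minor_move_front)
  then show ?thesis by simp
qed

text \<open>\<open>plucker_exchange\<close> for the sorted lists of \<open>Y\<close> and
  \<open>Z\<close>. Positions in \<open>Y\<close> correspond to elements through
  \<open>rank_in Y\<close>, and a \<open>y\<close> in \<open>Z\<close> contributes nothing because
  it repeats a row.\<close>

lemma flag_plucker:
  fixes u :: "nat \<Rightarrow> nat \<Rightarrow> 'a::idom"
  assumes "finite Y" "finite Z" "card Z + 2 \<le> card Y"
  shows "(\<Sum>y\<in>Y - Z. (-1) ^ (rank_in Y y + rank_in Z y) *
    flag_minor u (insert y Z) * flag_minor u (Y - {y})) = 0"
proof -
  let ?L = "sorted_list_of_set Y" and ?M = "sorted_list_of_set Z"
  define N where "N = card Y - 1"
  have N: "length ?L = Suc N" "length ?M < N" using assms by (auto simp: N_def)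
  let ?f = "\<lambda>y. (-1) ^ rank_in Y y * minor u (y # ?M) * flag_minor u (Y - {y})"
  have inj: "rank_in Y y < Suc N" "?L ! rank_in Y y = y" if "y \<in> Y" for y
    using sorted_list_of_set_nth_rank[OF assms(1) that] N by auto
  have rank: "rank_in Y (?L ! a) = a" if "a < Suc N" for a
  proof -
    have "?L ! a \<in> Y" using that N assms(1) by (metis nth_mem set_sorted_list_of_set)
    from inj[OF this] show ?thesis using that N
      by (metis distinct_sorted_list_of_set nth_eq_iff_index_eq)
  qed
  have "(\<Sum>y\<in>Y - Z. (-1) ^ (rank_in Y y + rank_in Z y) *
      flag_minor u (insert y Z) * flag_minor u (Y - {y})) = (\<Sum>y\<in>Y - Z. ?f y)"
    by (intro sum.cong) (simp_all add: minor_Cons_flag[OF assms(2)] power_add mult_ac)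
  also have "\<dots> = (\<Sum>y\<in>Y. ?f y)"
    using assms minor_Cons_eq_0[of _ ?M u] by (intro sum.mono_neutral_left) auto
  also have "\<dots> = (\<Sum>a<Suc N. (-1) ^ a * minor u (?L ! a # ?M) * minor u (take a ?L @ drop (Suc a) ?L))"
  proof (rule sum.reindex_bij_witness[of _ "\<lambda>a. ?L ! a" "rank_in Y"])
    fix a assume "a \<in> {..<Suc N}"
    then have "a < length ?L" using N by simp
    then show "?L ! a \<in> Y" using assms(1) by (metis nth_mem set_sorted_list_of_set)
    show "rank_in Y (?L ! a) = a" using \<open>a \<in> _\<close> rank by simp
  qed (simp_all add: inj flag_minor_def sorted_list_of_set_nth_rank(3)[OF assms(1)])
  also have "\<dots> = 0" by (rule plucker_exchange[OF N])
  finally show ?thesis .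
qed

section \<open>The two three-term relations\<close>

lemma rank_in_insert:
  assumes "finite S" "x \<notin> S"
  shows "rank_in (insert x S) y = rank_in S y + (if x < y then 1 else 0)"
proof -
  have "{z \<in> insert x S. z < y} = (if x < y then insert x {z \<in> S. z < y} else {z \<in> S. z < y})"
    by auto
  then show ?thesis using assms by (simp add: rank_in_def)
qed

lemma flag_plucker_3:
  fixes u :: "nat \<Rightarrow> nat \<Rightarrow> 'a::idom"
  assumes "finite X" "i \<notin> X" "j \<notin> X" "k \<notin> X" "i < j" "j < k"
  shows "flag_minor u (X \<union> {i, k}) * flag_minor u (X \<union> {j}) =
    flag_minor u (X \<union> {i, j}) * flag_minor u (X \<union> {k}) + flag_minor u (X \<union> {i}) * flag_minor u (X \<union> {j, k})"
proof -
  let ?Y = "insert i (insert j (insert k X))"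
  define h where "h y = (-1) ^ (rank_in ?Y y + rank_in X y) *
    flag_minor u (insert y X) * flag_minor u (?Y - {y})" for y
  have D: "?Y - X = {i, j, k}" using assms by auto
  have "(\<Sum>y\<in>?Y - X. h y) = 0"
    unfolding h_def by (rule flag_plucker) (use assms in simp_all)
  then have 0: "h i + (h j + h k) = 0" unfolding D using assms by simp
  have E: "?Y - {i} = X \<union> {j, k}" "?Y - {j} = X \<union> {i, k}" "?Y - {k} = X \<union> {i, j}"
    using assms by auto
  have U: "insert y X = X \<union> {y}" for y by auto
  \<comment> \<open>The elements of \<open>X\<close> are counted in both ranks, so their signs
    cancel. What remains is the position among \<open>i\<close>, \<open>j\<close>, \<open>k\<close>,
    which gives the signs +, -, +.\<close>
  have s: "(-1::'a) ^ (a + a) = 1" for a :: nat by (simp flip: mult_2)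
  have "h i = flag_minor u (X \<union> {i}) * flag_minor u (X \<union> {j, k})"
    "h j = - (flag_minor u (X \<union> {j}) * flag_minor u (X \<union> {i, k}))"
    "h k = flag_minor u (X \<union> {k}) * flag_minor u (X \<union> {i, j})"
    unfolding h_def E U[symmetric] using assms by (simp_all add: rank_in_insert s)
  with 0 show ?thesis by (simp add: algebra_simps)
qed

text \<open>The exchange relation with \<open>i\<close> put into the smaller set and
  \<open>j\<close>, \<open>k\<close>, \<open>l\<close> into the larger one. As \<open>i\<close>
  precedes all three, it adds one to each rank in \<open>?Z\<close> and turns the signs into -, +,
  -.\<close>

lemma flag_plucker_4:
  fixes u :: "nat \<Rightarrow> nat \<Rightarrow> 'a::idom"
  assumes "finite X" "i \<notin> X" "j \<notin> X" "k \<notin> X" "l \<notin> X" "i < j" "j < k" "k < l"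
  shows "flag_minor u (X \<union> {i, k}) * flag_minor u (X \<union> {j, l}) =
    flag_minor u (X \<union> {i, j}) * flag_minor u (X \<union> {k, l}) + flag_minor u (X \<union> {i, l}) * flag_minor u (X \<union> {j, k})"
proof -
  let ?Y = "insert j (insert k (insert l X))" and ?Z = "insert i X"
  define h where "h y = (-1) ^ (rank_in ?Y y + rank_in ?Z y) *
    flag_minor u (insert y ?Z) * flag_minor u (?Y - {y})" for y
  have D: "?Y - ?Z = {j, k, l}" using assms by auto
  have "(\<Sum>y\<in>?Y - ?Z. h y) = 0"
    unfolding h_def by (rule flag_plucker) (use assms in simp_all)
  then have 0: "h j + (h k + h l) = 0" unfolding D using assms by simp
  have E: "?Y - {j} = X \<union> {k, l}" "?Y - {k} = X \<union> {j, l}" "?Y - {l} = X \<union> {j, k}"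
    using assms by auto
  have U: "insert y ?Z = X \<union> {i, y}" for y by auto
  have s: "(-1::'a) ^ (a + a) = 1" for a :: nat by (simp flip: mult_2)
  have r: "rank_in ?Y y = rank_in X y + (if j < y then 1 else 0) + (if k < y then 1 else 0)
      + (if l < y then 1 else 0)" "rank_in ?Z y = rank_in X y + (if i < y then 1 else 0)" for y
    using assms by (simp_all add: rank_in_insert)
  have "h j = - (flag_minor u (X \<union> {i, j}) * flag_minor u (X \<union> {k, l}))"
    "h k = flag_minor u (X \<union> {i, k}) * flag_minor u (X \<union> {j, l})"
    "h l = - (flag_minor u (X \<union> {i, l}) * flag_minor u (X \<union> {j, k}))"
    unfolding h_def E U r using assms by (simp_all add: s)
  with 0 show ?thesis by (simp add: algebra_simps)
qed

subsection \<open>Minors of the path matrix\<close>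

text \<open>Multilinearity in the rows: expanding the products in the Leibniz formula selects one
  summand \<open>\<rho> b\<close> from each row. The factor \<open>g b r\<close> is free of the
  column and comes out of the determinant.\<close>

lemma det_rows_sum:
  fixes g :: "nat \<Rightarrow> 'i \<Rightarrow> 'a::comm_ring_1"
  assumes "\<And>b. b < m \<Longrightarrow> finite (I b)"
  shows "det (mat m m (\<lambda>(b, c). \<Sum>r\<in>I b. g b r * h r c)) =
    (\<Sum>\<rho>\<in>PiE {..<m} I. (\<Prod>b<m. g b (\<rho> b)) * det (mat m m (\<lambda>(b, c). h (\<rho> b) c)))"
proof -
  let ?P = "{p. p permutes {0..<m}}"
  have *: "p b < m" if "p \<in> ?P" "b < m" for p b
    using that permutes_in_image[of p "{0..<m}" b] by simp
  have "det (mat m m (\<lambda>(b, c). \<Sum>r\<in>I b. g b r * h r c)) =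
      (\<Sum>p\<in>?P. signof p * (\<Prod>b<m. \<Sum>r\<in>I b. g b r * h r (p b)))"
    by (subst det_def'[of _ m]) (auto simp: atLeast0LessThan * intro!: sum.cong prod.cong)
  also have "\<dots> = (\<Sum>p\<in>?P. signof p * (\<Sum>\<rho>\<in>PiE {..<m} I. \<Prod>b<m. g b (\<rho> b) * h (\<rho> b) (p b)))"
    using assms by (subst prod_sum_PiE) auto
  also have "\<dots> = (\<Sum>\<rho>\<in>PiE {..<m} I. (\<Prod>b<m. g b (\<rho> b)) * (\<Sum>p\<in>?P. signof p * (\<Prod>b<m. h (\<rho> b) (p b))))"
    unfolding sum_distrib_left prod.distrib by (subst sum.swap) (simp add: mult_ac)
  also have "\<dots> = (\<Sum>\<rho>\<in>PiE {..<m} I. (\<Prod>b<m. g b (\<rho> b)) * det (mat m m (\<lambda>(b, c). h (\<rho> b) c)))"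
    by (subst det_def'[of _ m]) (auto simp: atLeast0LessThan * intro!: sum.cong prod.cong)
  finally show ?thesis .
qed

text \<open>
  \<open>path_gf b x p\<close> is the generating function of the paths from the source of row \<open>p\<close> to the sink of
  column \<open>b + 1\<close>; in the second equation \<open>r\<close> is the row in which the path leaves the first column.
\<close>

primrec path_gf :: "nat \<Rightarrow> (nat \<Rightarrow> nat \<Rightarrow> 'a::comm_ring_1) \<Rightarrow> nat \<Rightarrow> 'a" where
  "path_gf 0 x p = (\<Prod>a=1..p. x a 1)"
| "path_gf (Suc b) x p = (\<Sum>r=1..p. (\<Prod>a=r..p. x a 1) * path_gf b (\<lambda>a c. x a (Suc c)) r)"

text \<open>The possible exit rows: \<open>\<rho> b\<close> is the row in which the path from
  \<open>L ! Suc b\<close> leaves the first column. \<open>PiE\<close> makes the choices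
  extensional, so that each is counted once.\<close>

definition interlacings :: "nat list \<Rightarrow> (nat \<Rightarrow> nat) set" where
  "interlacings L = PiE {..<length L - 1} (\<lambda>b. {L ! b<..L ! Suc b})"

lemma prod_atLeastAtMost_concat:
  fixes y :: "nat \<Rightarrow> 'a::comm_monoid_mult"
  assumes "r \<le> Suc s" "s \<le> t"
  shows "(\<Prod>a=r..s. y a) * (\<Prod>a\<in>{s<..t}. y a) = (\<Prod>a=r..t. y a)"
  using assms by (subst prod.union_disjoint[symmetric]) (auto intro!: prod.cong)

lemma prod_greaterThanAtMost_concat:
  fixes y :: "nat \<Rightarrow> 'a::comm_monoid_mult"
  assumes "r \<le> s" "s \<le> t"
  shows "(\<Prod>a\<in>{r<..s}. y a) * (\<Prod>a\<in>{s<..t}. y a) = (\<Prod>a\<in>{r<..t}. y a)"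
  using assms by (subst prod.union_disjoint[symmetric]) (auto intro!: prod.cong)

text \<open>
  Subtracting from each row the suitable multiple of the preceding one clears the first column below
  its top entry and restricts the sum defining \<open>path_gf\<close> to the gap between two consecutive sources;
  multilinearity does the rest.
\<close>

lemma minor_path_gf_rec:
  fixes x :: "nat \<Rightarrow> nat \<Rightarrow> 'a::comm_ring_1"
  assumes L: "sorted_wrt (<) L" "length L = Suc m" and pos: "1 \<le> L ! 0"
  shows "minor (\<lambda>p b. path_gf b x p) L = (\<Prod>a=1..L ! 0. x a 1) *
    (\<Sum>\<rho>\<in>interlacings L. (\<Prod>b<m. \<Prod>a=\<rho> b..L ! Suc b. x a 1) *
      minor (\<lambda>p b. path_gf b (\<lambda>a c. x a (Suc c)) p) (map \<rho> [0..<m]))"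
proof -
  define y where "y a = x a 1" for a
  define h where "h r c = path_gf c (\<lambda>a c. x a (Suc c)) r" for r c
  \<comment> \<open>The path matrix after row reduction. In column 0 only the top entry survives.
    Every other column sums over exits in one gap, and the index \<open>c - 1\<close> records that
    one grid column has been used up.\<close>
  define K where "K b c = (if c = 0 then (if b = 0 then \<Prod>a=1..L ! 0. y a else 0)
    else \<Sum>r\<in>{(if b = 0 then 0 else L ! (b - 1))<..L ! b}. (\<Prod>a=r..L ! b. y a) * h r (c - 1))" for b c
  \<comment> \<open>The factor that undoes the reduction: the path matrix will be
    \<open>E * A'\<close>. It is lower triangular with empty products, hence ones, on the diagonal,
    so \<open>det E = 1\<close>.\<close>
  define E where "E = mat (Suc m) (Suc m) (\<lambda>(a, b). if b \<le> a then \<Prod>a\<in>{L ! b<..L ! a}. y a else 0)"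
  define A' where "A' = mat (Suc m) (Suc m) (\<lambda>(b, c). K b c)"
  have mono: "L ! a \<le> L ! b" if "a \<le> b" "b < Suc m" for a b
    using that L by (cases "a = b") (auto simp: sorted_wrt_iff_nth_less less_imp_le)
  \<comment> \<open>A path from row \<open>t\<close> either leaves the first column below row
    \<open>s\<close>, or climbs to row \<open>s\<close> and continues like a path from
    there.\<close>
  have step: "path_gf c x t = (\<Prod>a\<in>{s<..t}. y a) * path_gf c x s +
      (if c = 0 then 0 else \<Sum>r\<in>{s<..t}. (\<Prod>a=r..t. y a) * h r (c - 1))" if "s \<le> t" for c s t
  proof (cases c)
    case 0
    then show ?thesis using that prod_atLeastAtMost_concat[of 1 s t y] by (simp add: y_def mult.commute)
  next
    case (Suc d)
    have "path_gf c x t = (\<Sum>r\<in>{1..s} \<union> {s<..t}. (\<Prod>a=r..t. y a) * h r d)"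
      using that unfolding Suc path_gf.simps h_def y_def by (intro sum.cong) auto
    also have "\<dots> = (\<Sum>r=1..s. (\<Prod>a=r..t. y a) * h r d) + (\<Sum>r\<in>{s<..t}. (\<Prod>a=r..t. y a) * h r d)"
      by (intro sum.union_disjoint) auto
    also have "(\<Sum>r=1..s. (\<Prod>a=r..t. y a) * h r d) = (\<Prod>a\<in>{s<..t}. y a) * path_gf c x s"
      unfolding Suc path_gf.simps sum_distrib_left
    proof (rule sum.cong[OF refl])
      fix r assume "r \<in> {1..s}"
      then show "(\<Prod>a=r..t. y a) * h r d = (\<Prod>a\<in>{s<..t}. y a) * ((\<Prod>a=r..s. x a 1) *
          path_gf d (\<lambda>a c. x a (Suc c)) r)"
        using that by (subst prod_atLeastAtMost_concat[of r s t y, symmetric]) (auto simp: h_def y_def mult_ac)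
    qed
    finally show ?thesis using Suc by simp
  qed
  have sum: "(\<Sum>b\<le>a. (\<Prod>a\<in>{L ! b<..L ! a}. y a) * K b c) = path_gf c x (L ! a)" if "a < Suc m" for a c
    using that
  proof (induction a)
    case 0
    then show ?case by (cases c) (auto simp: K_def y_def h_def intro!: sum.cong)
  next
    case (Suc a)
    have "(\<Sum>b\<le>Suc a. (\<Prod>a\<in>{L ! b<..L ! Suc a}. y a) * K b c) =
        (\<Sum>b\<le>a. (\<Prod>a\<in>{L ! b<..L ! Suc a}. y a) * K b c) + K (Suc a) c" by simp
    also have "(\<Sum>b\<le>a. (\<Prod>a\<in>{L ! b<..L ! Suc a}. y a) * K b c) =
        (\<Prod>a\<in>{L ! a<..L ! Suc a}. y a) * (\<Sum>b\<le>a. (\<Prod>a\<in>{L ! b<..L ! a}. y a) * K b c)"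
      unfolding sum_distrib_left
    proof (rule sum.cong[OF refl])
      fix b assume "b \<in> {..a}"
      then show "(\<Prod>a\<in>{L ! b<..L ! Suc a}. y a) * K b c =
          (\<Prod>a\<in>{L ! a<..L ! Suc a}. y a) * ((\<Prod>a\<in>{L ! b<..L ! a}. y a) * K b c)"
        using mono Suc.prems
        by (subst prod_greaterThanAtMost_concat[of "L ! b" "L ! a" "L ! Suc a" y, symmetric]) (auto simp: mult_ac)
    qed
    also have "(\<Sum>b\<le>a. (\<Prod>a\<in>{L ! b<..L ! a}. y a) * K b c) = path_gf c x (L ! a)"
      using Suc by simp
    also have "(\<Prod>a\<in>{L ! a<..L ! Suc a}. y a) * path_gf c x (L ! a) + K (Suc a) c = path_gf c x (L ! Suc a)"
      using step[of "L ! a" "L ! Suc a" c] mono[of a "Suc a"] Suc.prems by (simp add: K_def)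
    finally show ?case .
  qed
  have car: "E \<in> carrier_mat (Suc m) (Suc m)" "A' \<in> carrier_mat (Suc m) (Suc m)"
    by (simp_all add: E_def A'_def)
  have "mat (Suc m) (Suc m) (\<lambda>(a, c). path_gf c x (L ! a)) = E * A'"
  proof (rule eq_matI)
    fix a c assume "a < dim_row (E * A')" "c < dim_col (E * A')"
    then have ac: "a < Suc m" "c < Suc m" by (simp_all add: E_def A'_def)
    have "(E * A') $$ (a, c) = (\<Sum>b\<in>{0..<Suc m}. E $$ (a, b) * A' $$ (b, c))"
      using ac by (simp add: E_def A'_def scalar_prod_def)
    also have "\<dots> = (\<Sum>b\<le>a. (\<Prod>a\<in>{L ! b<..L ! a}. y a) * K b c)"
      using ac by (intro sum.mono_neutral_cong_right) (auto simp: E_def A'_def)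
    finally show "mat (Suc m) (Suc m) (\<lambda>(a, c). path_gf c x (L ! a)) $$ (a, c) = (E * A') $$ (a, c)"
      using ac sum[OF ac(1)] by simp
  qed (simp_all add: E_def A'_def)
  then have "minor (\<lambda>p b. path_gf b x p) L = det E * det A'"
    using det_mult[OF car] by (simp add: minor_def L)
  moreover have "det E = 1"
  proof -
    have "diag_mat E = replicate (Suc m) 1"
      by (rule nth_equalityI) (simp_all add: diag_mat_def E_def del: upt_Suc replicate_Suc)
    moreover have "det E = prod_list (diag_mat E)"
      by (rule det_lower_triangular[OF _ car(1)]) (simp add: E_def)
    ultimately show ?thesis by simp
  qed
  moreover have "det A' = (\<Prod>a=1..L ! 0. y a) * det (mat_delete A' 0 0)"
  proof -
    have "det A' = (\<Sum>i<Suc m. A' $$ (i, 0) * cofactor A' i 0)"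
      by (rule laplace_expansion_column[OF car(2)]) simp
    also have "\<dots> = (\<Sum>i\<in>{0}. A' $$ (i, 0) * cofactor A' i 0)"
      by (rule sum.mono_neutral_right) (auto simp: A'_def K_def)
    finally show ?thesis by (simp add: A'_def K_def cofactor_def)
  qed
  moreover have "mat_delete A' 0 0 =
      mat m m (\<lambda>(b, c). \<Sum>r\<in>{L ! b<..L ! Suc b}. (\<Prod>a=r..L ! Suc b. y a) * h r c)"
    by (rule eq_matI) (auto simp: mat_delete_def A'_def K_def)
  moreover have "det (mat m m (\<lambda>(b, c). h (\<rho> b) c)) =
      minor (\<lambda>p b. path_gf b (\<lambda>a c. x a (Suc c)) p) (map \<rho> [0..<m])" for \<rho>
    by (auto simp: minor_def h_def intro!: arg_cong[of _ _ det] cong_mat)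
  ultimately show ?thesis
    using det_rows_sum[of m "\<lambda>b. {L ! b<..L ! Suc b}" "\<lambda>b r. \<Prod>a=r..L ! Suc b. y a" h]
    by (simp add: L interlacings_def y_def)
qed

subsection \<open>Tropicalization\<close>

text \<open>
  \<open>g\<close> is a positive function of \<open>t\<close> whose leading exponent is \<open>f\<close>, so that \<open>ln (g t) / t\<close> tends to
  \<open>f\<close> as \<open>t\<close> grows.
\<close>

definition tropicalizes :: "(real \<Rightarrow> real) \<Rightarrow> real \<Rightarrow> bool" where
  "tropicalizes g f \<longleftrightarrow> (\<exists>N. \<forall>t>0. exp (t * f) \<le> g t \<and> g t \<le> N * exp (t * f))"

lemma tropicalizes_exp: "tropicalizes (\<lambda>t. exp (t * f)) f"
  unfolding tropicalizes_def by (rule exI[of _ 1]) simp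

lemma tropicalizes_mult:
  assumes "tropicalizes g f" "tropicalizes g' f'"
  shows "tropicalizes (\<lambda>t. g t * g' t) (f + f')"
proof -
  from assms obtain N N' where
    N: "\<And>t. t > 0 \<Longrightarrow> exp (t * f) \<le> g t \<and> g t \<le> N * exp (t * f)" and
    N': "\<And>t. t > 0 \<Longrightarrow> exp (t * f') \<le> g' t \<and> g' t \<le> N' * exp (t * f')"
    unfolding tropicalizes_def by blast
  have "exp (t * (f + f')) \<le> g t * g' t \<and> g t * g' t \<le> N * N' * exp (t * (f + f'))" if "t > 0" for t
  proof
    have pos: "0 \<le> g t" "0 \<le> g' t"
      using N[OF that] N'[OF that] exp_gt_zero[of "t * f"] exp_gt_zero[of "t * f'"] by linarith+
    have "exp (t * f) * exp (t * f') \<le> g t * g' t"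
      using N[OF that] N'[OF that] pos by (intro mult_mono) auto
    then show "exp (t * (f + f')) \<le> g t * g' t" by (simp add: distrib_left exp_add)
    have "g t * g' t \<le> (N * exp (t * f)) * (N' * exp (t * f'))"
      using N[OF that] N'[OF that] pos by (intro mult_mono) (auto intro: order_trans)
    then show "g t * g' t \<le> N * N' * exp (t * (f + f'))"
      by (simp add: distrib_left exp_add mult_ac)
  qed
  then show ?thesis unfolding tropicalizes_def by blast
qed

text \<open>All summands are nonnegative, so nothing cancels: a summand with maximal exponent bounds
  the sum from below, and adding up the constants bounds it from above.\<close>

lemma tropicalizes_sum:
  assumes "finite A" "A \<noteq> {}" "\<And>a. a \<in> A \<Longrightarrow> tropicalizes (g a) (f a)"
  shows "tropicalizes (\<lambda>t. \<Sum>a\<in>A. g a t) (Max (f ` A))"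
proof -
  from assms(3) obtain N where
    N: "\<And>a t. a \<in> A \<Longrightarrow> t > 0 \<Longrightarrow> exp (t * f a) \<le> g a t \<and> g a t \<le> N a * exp (t * f a)"
    unfolding tropicalizes_def by metis
  have pos: "0 \<le> g a t" if "a \<in> A" "t > 0" for a t
    using N[OF that] exp_gt_zero[of "t * f a"] by linarith
  have "Max (f ` A) \<in> f ` A" using assms(1,2) by (intro Max_in) auto
  then obtain a0 where a0: "a0 \<in> A" "Max (f ` A) = f a0" by auto
  have "exp (t * Max (f ` A)) \<le> (\<Sum>a\<in>A. g a t) \<and>
      (\<Sum>a\<in>A. g a t) \<le> (\<Sum>a\<in>A. N a) * exp (t * Max (f ` A))" if "t > 0" for t
  proof
    have "exp (t * Max (f ` A)) \<le> g a0 t" using N[OF a0(1) that] a0(2) by simp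
    also have "\<dots> \<le> (\<Sum>a\<in>A. g a t)"
      using assms(1) a0(1) pos that by (intro member_le_sum) auto
    finally show "exp (t * Max (f ` A)) \<le> (\<Sum>a\<in>A. g a t)" .
    have "g a t \<le> N a * exp (t * Max (f ` A))" if a: "a \<in> A" for a
    proof -
      have "0 \<le> N a * exp (t * f a)" using N[OF a \<open>t > 0\<close>] pos[OF a \<open>t > 0\<close>] by linarith
      then have "0 \<le> N a" by (simp add: zero_le_mult_iff)
      moreover have "f a \<le> Max (f ` A)" using a assms(1) by simp
      ultimately have "N a * exp (t * f a) \<le> N a * exp (t * Max (f ` A))"
        using \<open>t > 0\<close> by (intro mult_left_mono) auto
      then show ?thesis using N[OF a \<open>t > 0\<close>] by linarith
    qed
    then show "(\<Sum>a\<in>A. g a t) \<le> (\<Sum>a\<in>A. N a) * exp (t * Max (f ` A))"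
      by (simp add: sum_distrib_right sum_mono)
  qed
  then show ?thesis unfolding tropicalizes_def by blast
qed

lemma tropicalizes_add:
  assumes "tropicalizes g f" "tropicalizes g' f'"
  shows "tropicalizes (\<lambda>t. g t + g' t) (max f f')"
proof -
  have "tropicalizes (\<lambda>t. \<Sum>a\<in>{True, False}. (if a then g else g') t)
      (Max ((\<lambda>a. if a then f else f') ` {True, False}))"
    using assms by (intro tropicalizes_sum) auto
  then show ?thesis by (simp add: max.commute)
qed

lemma tropicalizes_le:
  assumes "tropicalizes g f" "tropicalizes g f'"
  shows "f \<le> f'"
proof (rule ccontr)
  assume "\<not> f \<le> f'"
  then have d: "f - f' > 0" by simp
  from assms obtain N where N: "\<And>t. t > 0 \<Longrightarrow> exp (t * f) \<le> g t \<and> g t \<le> N * exp (t * f')"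
    unfolding tropicalizes_def by blast
  \<comment> \<open>Chosen so that \<open>t * (f - f')\<close> equals
    \<open>\<bar>N\<bar> + 1\<close>. Its exponential then exceeds \<open>N\<close>, against the two
    bounds on \<open>g t\<close>.\<close>
  define t where "t = (\<bar>N\<bar> + 1) / (f - f')"
  have t: "t > 0" using d by (simp add: t_def)
  have "exp (t * (f - f')) * exp (t * f') = exp (t * f)"
    by (simp flip: exp_add add: algebra_simps)
  also have "\<dots> \<le> N * exp (t * f')" using N[OF t] by linarith
  finally have "exp (t * (f - f')) \<le> N" by simp
  moreover have "t * (f - f') = \<bar>N\<bar> + 1" using d by (simp add: t_def)
  ultimately show False using exp_ge_add_one_self[of "t * (f - f')"] by linarith
qed

lemma tropicalizes_unique:
  "tropicalizes g f \<Longrightarrow> tropicalizes g f' \<Longrightarrow> f = f'"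
  by (intro order_antisym tropicalizes_le)

subsection \<open>Flows and their decomposition along the first column\<close>

text \<open>The bounds of the grid are left out, so that shifting all columns by one preserves
  steps.\<close>

definition grid_step :: "nat \<times> nat \<Rightarrow> nat \<times> nat \<Rightarrow> bool" where
  "grid_step u v \<longleftrightarrow> fst u = Suc (fst v) \<and> snd v = snd u \<or> fst v = fst u \<and> snd v = Suc (snd u)"

definition grid_path :: "nat \<Rightarrow> nat \<Rightarrow> (nat \<times> nat) list \<Rightarrow> bool" where
  "grid_path n m' P \<longleftrightarrow> P \<noteq> [] \<and> set P \<subseteq> {1..n} \<times> {1..m'} \<and> successively grid_step P"

lemma arcs_ends_grid:
  "(u, v) \<in> arcs_ends (grid n m') \<longleftrightarrow>
    u \<in> {1..n} \<times> {1..m'} \<and> v \<in> {1..n} \<times> {1..m'} \<and> grid_step u v"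
proof -
  have "(u, v) \<in> arcs_ends (grid n m') \<longleftrightarrow> (u, v) \<in> arcs (grid n m')"
    by (force simp: arcs_ends_def arc_to_ends_def grid_def)
  also have "\<dots> \<longleftrightarrow> u \<in> {1..n} \<times> {1..m'} \<and> v \<in> {1..n} \<times> {1..m'} \<and> grid_step u v"
    by (cases u; cases v) (auto simp: grid_def grid_step_def)
  finally show ?thesis .
qed

lemma set_vwalk_arcs_subset_iff:
  "set (vwalk_arcs P) \<subseteq> R \<longleftrightarrow> successively (\<lambda>u v. (u, v) \<in> R) P"
  by (induction P rule: vwalk_arcs.induct) auto

text \<open>Distinctness is automatic: column index minus row index increases with every step. The
  relation \<open>?R\<close> says so without subtraction of naturals.\<close>

lemma vpath_grid_iff: "vpath P (grid n m') \<longleftrightarrow> grid_path n m' P"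
proof -
  have "distinct P" if "successively grid_step P"
  proof -
    let ?R = "\<lambda>u v :: nat \<times> nat. snd u + fst v < snd v + fst u"
    have "successively ?R P"
      by (rule successively_mono[OF that]) (auto simp: grid_step_def)
    then have "sorted_wrt ?R P"
      by (subst (asm) successively_conv_sorted_wrt) (auto simp: transp_def)
    then show ?thesis by (induction P) auto
  qed
  moreover have "successively (\<lambda>u v. (u, v) \<in> arcs_ends (grid n m')) P \<longleftrightarrow> successively grid_step P"
    if "set P \<subseteq> {1..n} \<times> {1..m'}"
    using that by (intro successively_cong) (auto simp: arcs_ends_grid)
  ultimately show ?thesis
    unfolding vpath_def vwalk_def grid_path_def set_vwalk_arcs_subset_iff
    by (auto simp: grid_def)
qed

definition first_col :: "nat \<Rightarrow> nat \<Rightarrow> (nat \<times> nat) list" where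
  "first_col s r = map (\<lambda>a. (a, 1)) (rev [r..<Suc s])"

lemma set_first_col: "set (first_col s r) = {r..s} \<times> {1}"
  by (auto simp: first_col_def)

lemma first_col_eq_Nil_iff: "first_col s r = [] \<longleftrightarrow> s < r"
  by (auto simp: first_col_def)

lemma hd_first_col: "r \<le> s \<Longrightarrow> hd (first_col s r) = (s, 1)"
  by (simp add: first_col_def)

lemma last_first_col: "r \<le> s \<Longrightarrow> last (first_col s r) = (r, 1)"
  by (simp add: first_col_def last_map last_rev del: upt_Suc)

lemma first_col_Suc: "r \<le> Suc s \<Longrightarrow> first_col (Suc s) r = (Suc s, 1) # first_col s r"
  by (simp add: first_col_def)

lemma successively_first_col: "successively grid_step (first_col s r)"
proof (induction s)
  case 0
  then show ?case by (cases r) (simp_all add: first_col_def)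
next
  case (Suc s)
  consider "Suc s < r" | "r = Suc s" | "r \<le> s" by linarith
  then show ?case
  proof cases
    case 1
    then show ?thesis by (metis first_col_eq_Nil_iff successively.simps(1))
  next
    case 2
    then show ?thesis by (simp add: first_col_def)
  next
    case 3
    then show ?thesis using Suc
      by (simp add: first_col_Suc successively_Cons hd_first_col) (simp add: grid_step_def)
  qed
qed

lemma grid_path_snd_ge:
  assumes "successively grid_step P" "v \<in> set P"
  shows "snd (hd P) \<le> snd v"
  using assms
proof (induction P)
  case (Cons u P)
  then show ?case by (cases P) (force simp: grid_step_def)+
qed simp

lemma grid_path_first_col_append:
  assumes "grid_path n (m' - 1) P" "hd P = (r, 1)" "r \<le> s" "s \<le> n"
  shows "grid_path n m' (first_col s r @ map (apsnd Suc) P)"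
proof -
  have P: "P \<noteq> []" "set P \<subseteq> {1..n} \<times> {1..m' - 1}" "successively grid_step P"
    using assms(1) by (auto simp: grid_path_def)
  have "hd P \<in> set P" using P(1) by simp
  then have r: "1 \<le> r" "1 \<le> m'" using P(2) assms(2) by auto
  have "successively grid_step (map (apsnd Suc) P)"
    unfolding successively_map by (rule successively_mono[OF P(3)]) (auto simp: grid_step_def)
  moreover have "grid_step (r, 1) (hd (map (apsnd Suc) P))"
    using P(1) assms(2) by (simp add: hd_map grid_step_def)
  ultimately show ?thesis
    using P(1,2) assms(3,4) r
    by (fastforce simp: grid_path_def set_first_col successively_append_iff successively_first_col last_first_col)
qed

lemma grid_path_first_col:
  assumes "1 \<le> r" "r \<le> s" "s \<le> n" "1 \<le> m'"
  shows "grid_path n m' (first_col s r)"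
  using assms by (auto simp: grid_path_def set_first_col successively_first_col first_col_eq_Nil_iff)

text \<open>Here \<open>r\<close> is the last row visited in the first column, found by induction
  along the path. The path either ends there or steps right, and the rest is a path of the narrower
  grid, moved by one column.\<close>

lemma grid_path_cases:
  assumes "grid_path n m' P" "hd P = (s, 1)"
  shows "\<exists>r\<in>{1..s}. P = first_col s r \<or>
    (\<exists>P'. grid_path n (m' - 1) P' \<and> hd P' = (r, 1) \<and> P = first_col s r @ map (apsnd Suc) P')"
  using assms
proof (induction P arbitrary: s)
  case Nil
  then show ?case by (simp add: grid_path_def)
next
  case (Cons v P)
  have v: "v = (s, 1)" "1 \<le> s" using Cons.prems by (auto simp: grid_path_def)
  have ss: "first_col s s = [(s, 1)]" by (simp add: first_col_def)
  show ?case
  proof (cases "P = []")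
    case True
    then show ?thesis using v ss by (intro bexI[of _ s]) auto
  next
    case False
    then have P: "grid_path n m' P" and st: "grid_step v (hd P)"
      using Cons.prems by (auto simp: grid_path_def successively_Cons)
    obtain p q where pq: "hd P = (p, q)" by fastforce
    consider "s = Suc p" "q = 1" | "p = s" "q = 2"
      using st v pq by (auto simp: grid_step_def)
    then show ?thesis
    proof cases
      case 1
      from Cons.IH[OF P, of p] pq 1 obtain r where r: "r \<in> {1..p}" and
        d: "P = first_col p r \<or>
          (\<exists>P'. grid_path n (m' - 1) P' \<and> hd P' = (r, 1) \<and> P = first_col p r @ map (apsnd Suc) P')"
        by auto
      have "first_col s r = v # first_col p r" using r 1 v by (simp add: first_col_Suc)
      then show ?thesis using d r 1 by (intro bexI[of _ r]) auto
    next
      case 2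
      \<comment> \<open>Moving left by one column loses nothing: columns never decrease along a
        path, so all of \<open>P\<close> lies in columns from 2 on.\<close>
      define P' where "P' = map (apsnd (\<lambda>q. q - 1)) P"
      have ge: "2 \<le> snd u" if "u \<in> set P" for u
        using grid_path_snd_ge[of P u] that P pq 2 by (simp add: grid_path_def)
      have eq: "map (apsnd Suc) P' = P"
        unfolding P'_def map_map by (rule map_idI) (use ge in force)
      have "successively grid_step P'"
        unfolding P'_def successively_map
        by (rule successively_mono[of grid_step]) (use P ge in \<open>auto simp: grid_path_def grid_step_def\<close>)
      moreover have "set P' \<subseteq> {1..n} \<times> {1..m' - 1}"
        unfolding P'_def using P ge by (fastforce simp: grid_path_def)
      ultimately have "grid_path n (m' - 1) P'" using False by (simp add: grid_path_def P'_def)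
      moreover have "hd P' = (s, 1)" using False pq 2 by (simp add: P'_def hd_map)
      ultimately show ?thesis using v ss eq by (intro bexI[of _ s] disjI2 exI[of _ P']) auto
    qed
  qed
qed

lemma path_weight_first_col: "path_weight w (first_col s r) = (\<Sum>a=r..s. w a 1)"
  by (simp add: path_weight_def set_first_col sum.cartesian_product[symmetric])

lemma path_weight_first_col_append:
  assumes "grid_path n m' P"
  shows "path_weight w (first_col s r @ map (apsnd Suc) P) =
    (\<Sum>a=r..s. w a 1) + path_weight (\<lambda>p q. w p (Suc q)) P"
proof -
  have "path_weight w (first_col s r @ map (apsnd Suc) P) =
      path_weight w (first_col s r) + path_weight w (map (apsnd Suc) P)"
    unfolding path_weight_def set_append
    using assms by (intro sum.union_disjoint) (force simp: set_first_col grid_path_def)+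
  moreover have "path_weight w (map (apsnd Suc) P) = path_weight (\<lambda>p q. w p (Suc q)) P"
    unfolding path_weight_def set_map
    by (subst sum.reindex) (auto simp: inj_on_def case_prod_unfold intro!: sum.cong)
  ultimately show ?thesis by (simp add: path_weight_first_col)
qed

section \<open>Admissible flows as families indexed by their sources\<close>

definition path_system :: "nat \<Rightarrow> nat \<Rightarrow> nat list \<Rightarrow> (nat \<Rightarrow> (nat \<times> nat) list) \<Rightarrow> bool" where
  "path_system n m' L P \<longleftrightarrow>
     (\<forall>b<length L. grid_path n m' (P b) \<and> hd (P b) = (L ! b, 1)) \<and>
     (\<forall>b<length L. \<forall>c<length L. b \<noteq> c \<longrightarrow> disjnt (set (P b)) (set (P c))) \<and>
     (\<lambda>b. last (P b)) ` {..<length L} = sink ` {1..length L}"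

lemma path_systemD:
  assumes "path_system n m' L P"
  shows "b < length L \<Longrightarrow> grid_path n m' (P b)"
    "b < length L \<Longrightarrow> P b \<noteq> []"
    "b < length L \<Longrightarrow> hd (P b) = (L ! b, 1)"
    "b < length L \<Longrightarrow> c < length L \<Longrightarrow> b \<noteq> c \<Longrightarrow> v \<in> set (P b) \<Longrightarrow> v \<notin> set (P c)"
    "(\<lambda>b. last (P b)) ` {..<length L} = sink ` {1..length L}"
  using assms unfolding path_system_def grid_path_def disjnt_def by blast+

lemma path_system_inj_on:
  assumes "path_system n m' L P"
  shows "inj_on P {..<length L}"
  using path_systemD(2,4)[OF assms] by (metis inj_onI lessThan_iff list.set_sel(1))

lemma flow_weight_path_system:
  assumes "path_system n m' L P"
  shows "flow_weight w (P ` {..<length L}) = (\<Sum>b<length L. path_weight w (P b))"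
  unfolding flow_weight_def by (subst sum.reindex[OF path_system_inj_on[OF assms]]) simp

lemma path_system_admissible:
  assumes P: "path_system n m' L P" and L: "set L \<subseteq> {1..n}" "length L \<le> m'"
  shows "P ` {..<length L} \<in> admissible_flows_for n m' (set L)"
proof -
  note D = path_systemD[OF P]
  have card: "card (P ` {..<length L}) = length L"
    using card_image[OF path_system_inj_on[OF P]] by simp
  have hd: "hd ` P ` {..<length L} = source ` set L"
    using D(3) by (force simp: image_image source_def in_set_conv_nth)
  have last: "last ` P ` {..<length L} = sink ` {1..length L}"
    using D(5) by (simp add: image_image)
  have "hd Q \<in> source ` {1..n}" "last Q \<in> sink ` {1..m'}" if "Q \<in> P ` {..<length L}" for Q
    using imageI[OF that, of hd] imageI[OF that, of last] L unfolding hd last by auto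
  then have "flow n m' (P ` {..<length L})"
    unfolding flow_def vpath_grid_iff using D(1) by blast
  moreover have "pairwise (\<lambda>P Q. disjnt (set P) (set Q)) (P ` {..<length L})"
    using P by (auto simp: path_system_def pairwise_def)
  ultimately show ?thesis
    using hd last by (simp add: admissible_flows_for_def admissible_def card)
qed

text \<open>By disjointness a path of the flow is determined by its first vertex, so the paths can
  be indexed by the entries of \<open>L\<close>. Which path reaches which sink stays open; only the
  set of sinks is fixed.\<close>

lemma admissible_path_system:
  assumes F: "F \<in> admissible_flows_for n m' (set L)" and L: "distinct L"
  shows "\<exists>P. path_system n m' L P \<and> F = P ` {..<length L}"
proof -
  have grid: "grid_path n m' Q" if "Q \<in> F" for Q
    using F that by (simp add: admissible_flows_for_def admissible_def flow_def vpath_grid_iff)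
  have disj: "disjnt (set Q) (set R)" if "Q \<in> F" "R \<in> F" "Q \<noteq> R" for Q R
    using F that by (auto simp: admissible_flows_for_def admissible_def pairwise_def)
  have last: "last ` F = sink ` {1..card F}" and hd: "hd ` F = source ` set L"
    using F by (auto simp: admissible_flows_for_def admissible_def)
  have eq: "Q = R" if "Q \<in> F" "R \<in> F" "hd Q = hd R" for Q R
  proof (rule ccontr)
    assume "Q \<noteq> R"
    then have "disjnt (set Q) (set R)" using disj that by blast
    moreover have "hd Q \<in> set Q" "hd R \<in> set R"
      using grid[OF that(1)] grid[OF that(2)] by (auto simp: grid_path_def)
    ultimately show False using that(3) by (metis disjnt_iff)
  qed
  have "\<exists>Q. Q \<in> F \<and> hd Q = (L ! b, 1)" if "b < length L" for b
  proof -
    have "source (L ! b) \<in> hd ` F" unfolding hd using that by simp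
    then show ?thesis by (auto simp: source_def)
  qed
  then obtain P where P: "P b \<in> F \<and> hd (P b) = (L ! b, 1)" if "b < length L" for b by metis
  have inj: "P b \<noteq> P c" if "b < length L" "c < length L" "b \<noteq> c" for b c
    using P[OF that(1)] P[OF that(2)] that L by (auto simp: nth_eq_iff_index_eq)
  have FP: "F = P ` {..<length L}"
  proof
    show "F \<subseteq> P ` {..<length L}"
    proof
      fix Q assume Q: "Q \<in> F"
      then have "hd Q \<in> source ` set L" using hd by blast
      then obtain b where b: "b < length L" "hd Q = (L ! b, 1)"
        by (auto simp: source_def in_set_conv_nth)
      then have "Q = P b" using eq[OF Q] P by auto
      then show "Q \<in> P ` {..<length L}" using b by simp
    qed
  qed (use P in auto)
  have "card F = length L" unfolding FP using inj by (subst card_image) (auto simp: inj_on_def)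
  with last have "(\<lambda>b. last (P b)) ` {..<length L} = sink ` {1..length L}"
    unfolding FP image_image by simp
  then have "path_system n m' L P"
    unfolding path_system_def using P grid disj inj by auto
  with FP show ?thesis by blast
qed

lemma path_weight_le_max_flow_weight:
  assumes "path_system n m' L P" "set L \<subseteq> {1..n}" "length L \<le> m'"
  shows "(\<Sum>b<length L. path_weight w (P b)) \<le> max_flow_weight n m' w (set L)"
  unfolding max_flow_weight_def flow_weight_path_system[OF assms(1), symmetric]
  using path_system_admissible[OF assms] finite_admissible_flows_for by (intro Max_ge) auto

lemma max_flow_weight_attained:
  assumes "distinct L" "set L \<subseteq> {1..n}" "length L \<le> m'"
  obtains P where "path_system n m' L P"
    "max_flow_weight n m' w (set L) = (\<Sum>b<length L. path_weight w (P b))"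
proof -
  \<comment> \<open>With 0 as lower bound the cube contains every set of at most \<open>m'\<close>
    sources, including the smaller ones met in the induction.\<close>
  have "set L \<in> truncated_cube n 0 m'"
    using assms by (simp add: truncated_cube_def distinct_card)
  then have "max_flow_weight n m' w (set L) \<in> flow_weight w ` admissible_flows_for n m' (set L)"
    unfolding max_flow_weight_def
    using finite_admissible_flows_for admissible_flows_for_nonempty by (intro Max_in) auto
  then obtain F where F: "F \<in> admissible_flows_for n m' (set L)"
    "max_flow_weight n m' w (set L) = flow_weight w F" by auto
  from admissible_path_system[OF F(1) assms(1)] obtain P where
    "path_system n m' L P" "F = P ` {..<length L}" by blast
  then show thesis using F(2) flow_weight_path_system that by metis
qed

lemma sink_image_Suc: "sink ` {1..Suc m} = insert (1, 1) (apsnd Suc ` sink ` {1..m})"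
proof -
  have "{1..Suc m} = insert 1 (Suc ` {1..m})" unfolding image_Suc_atLeastAtMost by auto
  then show ?thesis by (simp only: image_insert image_image sink_def apsnd_conv)
qed

text \<open>The path to the first sink never leaves the first column. It would meet every source
  above its own, so it starts at \<open>L ! 0\<close>. Any other path has to leave that column,
  whose only sink is taken, and does so before reaching the preceding source.\<close>

lemma path_system_split:
  assumes P: "path_system n m' L P" and L: "sorted_wrt (<) L" "length L = Suc m"
  obtains \<rho> P' where "P 0 = first_col (L ! 0) 1"
    "\<And>b. b < m \<Longrightarrow> L ! b < \<rho> b \<and> \<rho> b \<le> L ! Suc b"
    "\<And>b. b < m \<Longrightarrow> P (Suc b) = first_col (L ! Suc b) (\<rho> b) @ map (apsnd Suc) (P' b)"
    "path_system n (m' - 1) (map \<rho> [0..<m]) P'"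
proof -
  note D = path_systemD[OF P, unfolded L]
  have less: "L ! a < L ! b" if "a < b" "b < Suc m" for a b
    using L that by (auto simp: sorted_wrt_iff_nth_less)
  have src: "(L ! b, 1) \<in> set (P b)" if "b < Suc m" for b
    using D(2,3)[OF that] hd_in_set by metis
  have lst: "last (P b) \<in> set (P b)" if "b < Suc m" for b using D(2)[OF that] by simp
  have cases: "\<exists>r\<in>{1..L ! b}. P b = first_col (L ! b) r \<or>
      (\<exists>P'. grid_path n (m' - 1) P' \<and> hd P' = (r, 1) \<and> P b = first_col (L ! b) r @ map (apsnd Suc) P')"
    if "b < Suc m" for b
    using grid_path_cases[OF D(1,3)] that by blast
  have "sink 1 \<in> (\<lambda>b. last (P b)) ` {..<Suc m}" unfolding D(5) by simp
  then obtain e where e: "e < Suc m" "last (P e) = (1, 1)" by (auto simp: sink_def)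
  have Pe: "P e = first_col (L ! e) 1"
  proof -
    obtain r where r: "r \<in> {1..L ! e}" and d: "P e = first_col (L ! e) r \<or>
      (\<exists>P'. grid_path n (m' - 1) P' \<and> hd P' = (r, 1) \<and> P e = first_col (L ! e) r @ map (apsnd Suc) P')"
      using cases[OF e(1)] by blast
    have False if "grid_path n (m' - 1) P'" "P e = first_col (L ! e) r @ map (apsnd Suc) P'" for P'
    proof -
      have "P' \<noteq> []" "set P' \<subseteq> {1..n} \<times> {1..m' - 1}" using that(1) by (auto simp: grid_path_def)
      then have "last P' \<in> {1..n} \<times> {1..m' - 1}" by (meson last_in_set subsetD)
      moreover have "apsnd Suc (last P') = (1, 1)"
        using e(2) that(2) \<open>P' \<noteq> []\<close> by (simp add: last_map)
      ultimately show False by (cases "last P'") simp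
    qed
    then have "P e = first_col (L ! e) r" using d by blast
    then show ?thesis using e(2) r by (simp add: last_first_col)
  qed
  have "e = 0"
  proof (rule ccontr)
    assume "e \<noteq> 0"
    moreover have "1 \<le> L ! 0" using cases[of 0] by force
    ultimately have "(L ! 0, 1) \<in> set (P e)"
      using less[of 0 e] e(1) by (simp add: Pe set_first_col)
    then show False using D(4)[of e 0] src[of 0] e(1) \<open>e \<noteq> 0\<close> by simp
  qed
  with Pe e have P0: "P 0 = first_col (L ! 0) 1" "last (P 0) = (1, 1)" by simp_all
  have "\<exists>r P'. L ! b < r \<and> r \<le> L ! Suc b \<and> grid_path n (m' - 1) P' \<and> hd P' = (r, 1) \<and>
      P (Suc b) = first_col (L ! Suc b) r @ map (apsnd Suc) P'" if b: "b < m" for b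
  proof -
    have Sb: "Suc b < Suc m" using b by simp
    obtain r where r: "r \<in> {1..L ! Suc b}" and d: "P (Suc b) = first_col (L ! Suc b) r \<or>
      (\<exists>P'. grid_path n (m' - 1) P' \<and> hd P' = (r, 1) \<and>
        P (Suc b) = first_col (L ! Suc b) r @ map (apsnd Suc) P')"
      using cases[OF Sb] by blast
    have "P (Suc b) \<noteq> first_col (L ! Suc b) r"
    proof
      assume *: "P (Suc b) = first_col (L ! Suc b) r"
      have "last (P (Suc b)) \<in> (\<lambda>b. last (P b)) ` {..<Suc m}" using Sb by blast
      then have "snd (last (P (Suc b))) = 1 \<longrightarrow> last (P (Suc b)) = (1, 1)"
        unfolding D(5) by (auto simp: sink_def)
      moreover have "last (P (Suc b)) = (r, 1)" using * r by (simp add: last_first_col)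
      ultimately have "last (P (Suc b)) = last (P 0)" using P0 by simp
      then show False using D(4)[of "Suc b" 0 "last (P 0)"] lst[of 0] lst[OF Sb] Sb by simp
    qed
    moreover have "L ! b < r"
    proof (rule ccontr)
      assume "\<not> L ! b < r"
      then have "(L ! b, 1) \<in> set (first_col (L ! Suc b) r)"
        using less[of b "Suc b"] b by (simp add: set_first_col)
      then have "(L ! b, 1) \<in> set (P (Suc b))" using d by auto
      then show False using D(4)[of "Suc b" b] src[of b] b by simp
    qed
    ultimately show ?thesis using d r by auto
  qed
  then obtain \<rho> P' where *: "\<And>b. b < m \<Longrightarrow> L ! b < \<rho> b \<and> \<rho> b \<le> L ! Suc b \<and>
      grid_path n (m' - 1) (P' b) \<and> hd (P' b) = (\<rho> b, 1) \<and>
      P (Suc b) = first_col (L ! Suc b) (\<rho> b) @ map (apsnd Suc) (P' b)"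
    by metis
  have ne: "P' b \<noteq> []" if "b < m" for b using *[OF that] by (simp add: grid_path_def)
  have disj: "disjnt (set (P' b)) (set (P' c))" if "b < m" "c < m" "b \<noteq> c" for b c
    unfolding disjnt_iff
  proof (intro allI notI)
    fix v assume "v \<in> set (P' b) \<and> v \<in> set (P' c)"
    then have "apsnd Suc v \<in> set (P (Suc b))" "apsnd Suc v \<in> set (P (Suc c))"
      using *[OF that(1)] *[OF that(2)] by auto
    then show False using D(4)[of "Suc b" "Suc c"] that by simp
  qed
  \<comment> \<open>The endpoints of the remaining paths are found by removing \<open>(1, 1)\<close>
    from both sides of the sink condition and cancelling the injective shift.\<close>
  have "inj (apsnd Suc :: nat \<times> nat \<Rightarrow> _)" by (auto simp: inj_on_def)
  moreover have "apsnd Suc ` (\<lambda>b. last (P' b)) ` {..<m} = apsnd Suc ` sink ` {1..m}"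
  proof -
    have "(\<lambda>b. last (P b)) ` {..<Suc m} = insert (1, 1) ((\<lambda>b. last (P (Suc b))) ` {..<m})"
      by (simp only: lessThan_Suc_eq_insert_0 image_insert image_image P0(2))
    moreover have "(\<lambda>b. last (P (Suc b))) ` {..<m} = apsnd Suc ` (\<lambda>b. last (P' b)) ` {..<m}"
      unfolding image_image using * ne by (intro image_cong) (auto simp: last_map)
    moreover have "(1, 1) \<notin> apsnd Suc ` sink ` {1..m}" by (auto simp: sink_def)
    moreover have "(1, 1) \<notin> apsnd Suc ` (\<lambda>b. last (P' b)) ` {..<m}"
    proof
      assume "(1, 1) \<in> apsnd Suc ` (\<lambda>b. last (P' b)) ` {..<m}"
      then obtain b where b: "b < m" "apsnd Suc (last (P' b)) = (1, 1)" by force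
      then have "last (P' b) \<in> {1..n} \<times> {1..m' - 1}"
        using *[OF b(1)] ne[OF b(1)] unfolding grid_path_def by (meson last_in_set subsetD)
      then show False using b(2) by (cases "last (P' b)") simp
    qed
    ultimately show ?thesis using D(5) sink_image_Suc[of m] by (metis insert_ident)
  qed
  ultimately have "(\<lambda>b. last (P' b)) ` {..<m} = sink ` {1..m}" by (rule inj_image_eq_iff[THEN iffD1])
  then have "path_system n (m' - 1) (map \<rho> [0..<m]) P'"
    using * disj by (simp add: path_system_def)
  then show thesis using P0(1) * by (intro that[of \<rho> P']) blast+
qed

text \<open>Converse of \<open>path_system_split\<close>. In the first column, path
  \<open>Suc d\<close> keeps to rows from \<open>\<rho> d\<close> on, while a path \<open>b\<close>
  with \<open>b \<le> d\<close> keeps to rows up to \<open>L ! b < \<rho> d\<close>. In the other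
  columns disjointness is inherited from \<open>P'\<close>.\<close>

lemma path_system_join:
  assumes P: "path_system n (m' - 1) (map \<rho> [0..<m]) P'"
    and L: "sorted_wrt (<) L" "length L = Suc m" "set L \<subseteq> {1..n}" and m': "1 \<le> m'"
    and \<rho>: "\<And>b. b < m \<Longrightarrow> L ! b < \<rho> b \<and> \<rho> b \<le> L ! Suc b"
  shows "path_system n m' L
    (case_nat (first_col (L ! 0) 1) (\<lambda>b. first_col (L ! Suc b) (\<rho> b) @ map (apsnd Suc) (P' b)))"
proof -
  define P where "P = case_nat (first_col (L ! 0) 1)
    (\<lambda>b. first_col (L ! Suc b) (\<rho> b) @ map (apsnd Suc) (P' b))"
  have P_simps: "P 0 = first_col (L ! 0) 1"
    "P (Suc b) = first_col (L ! Suc b) (\<rho> b) @ map (apsnd Suc) (P' b)" for b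
    by (simp_all add: P_def)
  note D = path_systemD[OF P, unfolded length_map length_upt diff_zero]
  have hd': "hd (P' b) = (\<rho> b, 1)" if "b < m" for b using D(3)[OF that] that by simp
  have Lb: "1 \<le> L ! b" "L ! b \<le> n" if "b < Suc m" for b
    using that L by (metis atLeastAtMost_iff nth_mem subsetD)+
  have mono: "L ! a \<le> L ! b" if "a \<le> b" "b < Suc m" for a b
    using that L by (cases "a = b") (auto simp: sorted_wrt_iff_nth_less less_imp_le)
  have cols: "1 \<le> q" if "(p, q) \<in> set (P' b)" "b < m" for p q b
    using D(1)[OF that(2)] that(1) by (auto simp: grid_path_def)
  have path: "grid_path n m' (P b) \<and> hd (P b) = (L ! b, 1)" if "b < Suc m" for b
  proof (cases b)
    case 0
    then show ?thesis using Lb[of 0] m' by (simp add: P_simps grid_path_first_col hd_first_col)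
  next
    case (Suc c)
    then have c: "c < m" using that by simp
    have "first_col (L ! Suc c) (\<rho> c) \<noteq> []" using \<rho>[OF c] by (simp add: first_col_eq_Nil_iff)
    then show ?thesis
      using \<rho>[OF c] c Lb[of "Suc c"] D(1)[OF c] hd'[OF c]
      by (simp add: Suc P_simps grid_path_first_col_append hd_first_col)
  qed
  have disj: "disjnt (set (P b)) (set (P c))" if bc: "b < c" "c < Suc m" for b c
    unfolding disjnt_iff
  proof (intro allI notI)
    fix v assume v: "v \<in> set (P b) \<and> v \<in> set (P c)"
    obtain d where d: "c = Suc d" "d < m" using bc by (cases c) auto
    have low: "fst v \<le> L ! b" if "snd v = 1"
    proof (cases b)
      case 0
      then show ?thesis using v by (auto simp: P_simps set_first_col)
    next
      case (Suc a)
      then show ?thesis using v that cols[of _ _ a] bc by (fastforce simp: P_simps set_first_col)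
    qed
    show False
    proof (cases "snd v = 1")
      case True
      then have "\<rho> d \<le> fst v" using v d cols[of _ _ d] by (fastforce simp: P_simps set_first_col)
      then show False using low[OF True] \<rho>[OF d(2)] mono[of b d] bc d by simp
    next
      case False
      obtain a where a: "b = Suc a" using v False by (cases b) (auto simp: P_simps set_first_col)
      obtain u where u: "u \<in> set (P' a)" "v = apsnd Suc u"
        using v False by (auto simp: a P_simps set_first_col)
      obtain u' where u': "u' \<in> set (P' d)" "v = apsnd Suc u'"
        using v False by (auto simp: d P_simps set_first_col)
      have "u = u'" using u(2) u'(2) by (cases u; cases u') simp
      then show False using D(4)[of a d u] u u' bc a d by simp
    qed
  qed
  have "(\<lambda>b. last (P b)) ` {..<Suc m} = sink ` {1..Suc m}"
  proof -
    have "last (P (Suc b)) = apsnd Suc (last (P' b))" if "b < m" for b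
      using D(2)[OF that] by (simp add: P_simps last_map)
    then have "(\<lambda>b. last (P (Suc b))) ` {..<m} = apsnd Suc ` (\<lambda>b. last (P' b)) ` {..<m}"
      by (simp add: image_image)
    moreover have "last (P 0) = (1, 1)" using Lb[of 0] by (simp add: P_simps last_first_col)
    ultimately show ?thesis
      by (simp only: lessThan_Suc_eq_insert_0 image_insert image_image[of _ Suc] sink_image_Suc D(5))
  qed
  then show ?thesis
    unfolding P_def[symmetric] path_system_def L(2) using path disj disjnt_sym by (metis nat_neq_iff)
qed

section \<open>Recursion for the maximal flow weight\<close>

lemma finite_interlacings: "finite (interlacings L)"
  unfolding interlacings_def by (intro finite_PiE) auto

lemma interlacings_nonempty:
  assumes "sorted_wrt (<) L"
  shows "interlacings L \<noteq> {}"
proof -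
  have "L ! b < L ! Suc b" if "b < length L - 1" for b
    using assms that by (auto simp: sorted_wrt_iff_nth_less)
  then show ?thesis unfolding interlacings_def PiE_eq_empty_iff by force
qed

text \<open>For \<open>a < b\<close> one has
  \<open>\<rho> a \<le> L ! Suc a \<le> L ! b < \<rho> b\<close>, so the exit rows are again an
  increasing list of sources and the recursion can continue.\<close>

lemma interlacingsD:
  assumes "\<rho> \<in> interlacings L" "sorted_wrt (<) L" "length L = Suc m"
  shows "b < m \<Longrightarrow> L ! b < \<rho> b \<and> \<rho> b \<le> L ! Suc b"
    "sorted_wrt (<) (map \<rho> [0..<m])" "set L \<subseteq> {1..n} \<Longrightarrow> set (map \<rho> [0..<m]) \<subseteq> {1..n}"
proof -
  show *: "L ! b < \<rho> b \<and> \<rho> b \<le> L ! Suc b" if "b < m" for b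
    using assms that by (auto simp: interlacings_def PiE_def Pi_def)
  have mono: "L ! a \<le> L ! b" if "a \<le> b" "b < Suc m" for a b
    using that assms by (cases "a = b") (auto simp: sorted_wrt_iff_nth_less less_imp_le)
  have "\<rho> a < \<rho> b" if "a < b" "b < m" for a b
    using *[of a] *[of b] mono[of "Suc a" b] that by simp
  then show "sorted_wrt (<) (map \<rho> [0..<m])" by (simp add: sorted_wrt_iff_nth_less)
  show "set (map \<rho> [0..<m]) \<subseteq> {1..n}" if "set L \<subseteq> {1..n}"
  proof -
    have "L ! b \<in> {1..n}" if "b < Suc m" for b
      using that assms(3) \<open>set L \<subseteq> {1..n}\<close> by (metis nth_mem subsetD)
    then have "\<rho> b \<in> {1..n}" if "b < m" for b using *[OF that] that by fastforce
    then show ?thesis by auto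
  qed
qed

text \<open>The tropical counterpart of \<open>minor_path_gf_rec\<close>. Splitting an optimal flow
  gives one inequality, joining optimal flows of the narrower grid gives the other; the weight in
  the first column depends only on \<open>L\<close> and \<open>\<rho>\<close>.\<close>

lemma max_flow_weight_rec:
  assumes L: "sorted_wrt (<) L" "length L = Suc m" "set L \<subseteq> {1..n}" "length L \<le> m'"
  shows "max_flow_weight n m' w (set L) = (\<Sum>a=1..L ! 0. w a 1) +
    Max ((\<lambda>\<rho>. (\<Sum>b<m. \<Sum>a=\<rho> b..L ! Suc b. w a 1) +
      max_flow_weight n (m' - 1) (\<lambda>p q. w p (Suc q)) (set (map \<rho> [0..<m]))) ` interlacings L)"
    (is "?f = ?c + Max (?g ` _)")
proof (rule order_antisym)
  have dist: "distinct L" using L(1) by (simp add: strict_sorted_iff)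
  let ?w = "\<lambda>p q. w p (Suc q)"
  obtain P where P: "path_system n m' L P" "?f = (\<Sum>b<length L. path_weight w (P b))"
    using max_flow_weight_attained[OF dist L(3,4)] by blast
  obtain \<rho> P' where s: "P 0 = first_col (L ! 0) 1"
    "\<And>b. b < m \<Longrightarrow> L ! b < \<rho> b \<and> \<rho> b \<le> L ! Suc b"
    "\<And>b. b < m \<Longrightarrow> P (Suc b) = first_col (L ! Suc b) (\<rho> b) @ map (apsnd Suc) (P' b)"
    "path_system n (m' - 1) (map \<rho> [0..<m]) P'"
    using path_system_split[OF P(1) L(1,2)] by blast
  \<comment> \<open>Restriction makes \<open>\<rho>\<close> extensional, as membership in
    \<open>interlacings L\<close> demands.\<close>
  define \<sigma> where "\<sigma> = restrict \<rho> {..<m}"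
  have \<sigma>: "\<sigma> \<in> interlacings L" using s(2) L(2) by (auto simp: interlacings_def \<sigma>_def)
  have map: "map \<rho> [0..<m] = map \<sigma> [0..<m]" by (simp add: \<sigma>_def)
  have gp: "grid_path n (m' - 1) (P' b)" if "b < m" for b
    using path_systemD(1)[OF s(4)] that by simp
  have "?f = path_weight w (P 0) + (\<Sum>b<m. path_weight w (P (Suc b)))"
    unfolding P(2) L(2) sum.lessThan_Suc_shift by simp
  also have "\<dots> = ?c + ((\<Sum>b<m. \<Sum>a=\<sigma> b..L ! Suc b. w a 1) + (\<Sum>b<m. path_weight ?w (P' b)))"
    by (simp add: s(1,3) path_weight_first_col path_weight_first_col_append[OF gp] sum.distrib \<sigma>_def)
  also have "(\<Sum>b<m. path_weight ?w (P' b)) \<le> max_flow_weight n (m' - 1) ?w (set (map \<sigma> [0..<m]))"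
    using path_weight_le_max_flow_weight[OF s(4)[unfolded map], of ?w] interlacingsD(3)[OF \<sigma> L(1,2,3)] L(2,4)
    by simp
  also have "(\<Sum>b<m. \<Sum>a=\<sigma> b..L ! Suc b. w a 1) + \<dots> \<le> Max (?g ` interlacings L)"
    using \<sigma> finite_interlacings by (intro Max_ge) auto
  finally show "?f \<le> ?c + Max (?g ` interlacings L)" by simp
next
  let ?w = "\<lambda>p q. w p (Suc q)"
  have "?g \<rho> \<le> ?f - ?c" if \<rho>: "\<rho> \<in> interlacings L" for \<rho>
  proof -
    note I = interlacingsD[OF \<rho> L(1,2)]
    have "distinct (map \<rho> [0..<m])" using I(2) strict_sorted_iff by blast
    moreover have "length (map \<rho> [0..<m]) \<le> m' - 1" using L(2,4) by simp
    ultimately obtain P' where P': "path_system n (m' - 1) (map \<rho> [0..<m]) P'"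
      "max_flow_weight n (m' - 1) ?w (set (map \<rho> [0..<m])) =
        (\<Sum>b<length (map \<rho> [0..<m]). path_weight ?w (P' b))"
      using max_flow_weight_attained[OF _ I(3)[OF L(3)]] by blast
    have m': "1 \<le> m'" using L(2,4) by simp
    have gp: "grid_path n (m' - 1) (P' b)" if "b < m" for b
      using path_systemD(1)[OF P'(1)] that by simp
    let ?P = "case_nat (first_col (L ! 0) 1) (\<lambda>b. first_col (L ! Suc b) (\<rho> b) @ map (apsnd Suc) (P' b))"
    have "(\<Sum>b<length L. path_weight w (?P b)) \<le> ?f"
      using path_weight_le_max_flow_weight[OF path_system_join[OF P'(1) L(1-3) m' I(1)] L(3,4)] .
    moreover have "(\<Sum>b<length L. path_weight w (?P b)) = ?c + ?g \<rho>"
      unfolding P'(2) L(2) sum.lessThan_Suc_shift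
      by (simp add: path_weight_first_col path_weight_first_col_append[OF gp] sum.distrib)
    ultimately show ?thesis by simp
  qed
  then have "Max (?g ` interlacings L) \<le> ?f - ?c"
    using finite_interlacings interlacings_nonempty[OF L(1)] by (subst Max_le_iff) auto
  then show "?c + Max (?g ` interlacings L) \<le> ?f" by simp
qed

text \<open>\<open>minor_path_gf_rec\<close> and \<open>max_flow_weight_rec\<close> are one
  recursion, read with sums and products or with maxima and sums. The induction varies
  \<open>m'\<close> and \<open>w\<close> because each step drops a column.\<close>

lemma tropicalizes_minor:
  assumes "sorted_wrt (<) L" "set L \<subseteq> {1..n}" "length L \<le> m'"
  shows "tropicalizes (\<lambda>t. minor (\<lambda>p b. path_gf b (\<lambda>a c. exp (t * w a c)) p) L)
    (max_flow_weight n m' w (set L))"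
  using assms
proof (induction "length L" arbitrary: L m' w)
  case 0
  then have L: "L = []" by simp
  obtain P where "max_flow_weight n m' w (set L) = (\<Sum>b<length L. path_weight w (P b))"
    using max_flow_weight_attained[of L n m' w] L by auto
  \<comment> \<open>Without sources the weight is an empty sum, and the empty determinant is 1, that
    is \<open>exp (t * 0)\<close>.\<close>
  then show ?case using tropicalizes_exp[of 0] by (simp add: L minor_def det_dim_zero)
next
  case (Suc m)
  let ?w = "\<lambda>p q. w p (Suc q)"
  have len: "length L = Suc m" using Suc by simp
  have "L ! 0 \<in> set L" using len by simp
  then have pos: "1 \<le> L ! 0" using Suc.prems(2) by auto
  have exps: "(\<lambda>t. \<Prod>a=r..s. exp (t * w a 1)) = (\<lambda>t. exp (t * (\<Sum>a=r..s. w a 1)))" for r s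
    by (simp add: exp_sum sum_distrib_left)
  have IH: "tropicalizes (\<lambda>t. minor (\<lambda>p b. path_gf b (\<lambda>a c. exp (t * w a (Suc c))) p) (map \<rho> [0..<m]))
    (max_flow_weight n (m' - 1) ?w (set (map \<rho> [0..<m])))" if "\<rho> \<in> interlacings L" for \<rho>
    using interlacingsD(2,3)[OF that Suc.prems(1) len] Suc.prems(2,3) len
    by (intro Suc.hyps(1)) auto
  have "tropicalizes (\<lambda>t. (\<Prod>b<m. \<Prod>a=\<rho> b..L ! Suc b. exp (t * w a 1)) *
      minor (\<lambda>p b. path_gf b (\<lambda>a c. exp (t * w a (Suc c))) p) (map \<rho> [0..<m]))
    ((\<Sum>b<m. \<Sum>a=\<rho> b..L ! Suc b. w a 1) + max_flow_weight n (m' - 1) ?w (set (map \<rho> [0..<m])))"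
    if "\<rho> \<in> interlacings L" for \<rho>
  proof (rule tropicalizes_mult[OF _ IH[OF that]])
    show "tropicalizes (\<lambda>t. \<Prod>b<m. \<Prod>a=\<rho> b..L ! Suc b. exp (t * w a 1))
        (\<Sum>b<m. \<Sum>a=\<rho> b..L ! Suc b. w a 1)"
      using tropicalizes_exp[of "\<Sum>b<m. \<Sum>a=\<rho> b..L ! Suc b. w a 1"]
      by (simp add: exp_sum sum_distrib_left)
  qed
  then have "tropicalizes (\<lambda>t. \<Sum>\<rho>\<in>interlacings L. (\<Prod>b<m. \<Prod>a=\<rho> b..L ! Suc b. exp (t * w a 1)) *
      minor (\<lambda>p b. path_gf b (\<lambda>a c. exp (t * w a (Suc c))) p) (map \<rho> [0..<m]))
    (Max ((\<lambda>\<rho>. (\<Sum>b<m. \<Sum>a=\<rho> b..L ! Suc b. w a 1) +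
      max_flow_weight n (m' - 1) ?w (set (map \<rho> [0..<m]))) ` interlacings L))"
    using finite_interlacings interlacings_nonempty[OF Suc.prems(1)] by (intro tropicalizes_sum)
  moreover have "tropicalizes (\<lambda>t. \<Prod>a=1..L ! 0. exp (t * w a 1)) (\<Sum>a=1..L ! 0. w a 1)"
    unfolding exps by (rule tropicalizes_exp)
  ultimately show ?case
    unfolding max_flow_weight_rec[OF Suc.prems(1) len Suc.prems(2,3)]
      minor_path_gf_rec[OF Suc.prems(1) len pos]
    by (intro tropicalizes_mult)
qed

section \<open>Growth rates in the three-term relations\<close>

theorem theorem3p1:
  fixes n m m' :: nat and w :: "nat \<Rightarrow> nat \<Rightarrow> real"
  assumes "m \<le> m'" and "m' \<le> n"
  shows "TP_function n m m' (max_flow_weight n m' w)"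
proof -
  let ?f = "max_flow_weight n m' w"
  let ?u = "\<lambda>t p b. path_gf b (\<lambda>a c. exp (t * w a c)) p"
  have trop: "tropicalizes (\<lambda>t. flag_minor (?u t) S) (?f S)" if "S \<in> truncated_cube n m m'" for S
  proof -
    have S: "S \<subseteq> {1..n}" "card S \<le> m'" using that by (auto simp: truncated_cube_def)
    then have "finite S" using finite_subset by blast
    then show ?thesis
      using tropicalizes_minor[of "sorted_list_of_set S" n m' w] S by (simp add: flag_minor_def)
  qed
  \<comment> \<open>The two sides of a three-term relation are the same function of
    \<open>t\<close>. Its leading exponent is unique, so computing it from either side gives the
    same value.\<close>
  have relation: "?f A + ?f B = max (?f C + ?f D) (?f E + ?f F)"
    if "{A, B, C, D, E, F} \<subseteq> truncated_cube n m m'"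
      and "\<And>t. flag_minor (?u t) A * flag_minor (?u t) B =
        flag_minor (?u t) C * flag_minor (?u t) D + flag_minor (?u t) E * flag_minor (?u t) F"
    for A B C D E F
  proof (rule tropicalizes_unique)
    show "tropicalizes (\<lambda>t. flag_minor (?u t) A * flag_minor (?u t) B) (?f A + ?f B)"
      using that(1) by (intro tropicalizes_mult trop) auto
    show "tropicalizes (\<lambda>t. flag_minor (?u t) A * flag_minor (?u t) B)
        (max (?f C + ?f D) (?f E + ?f F))"
      unfolding that(2) using that(1) by (intro tropicalizes_add tropicalizes_mult trop) auto
  qed
  have fin: "finite X" if "X \<subseteq> {1..n} - Y" for X Y
    by (rule finite_subset[OF that]) simp
  show ?thesis
    unfolding TP_function_def
  proof (intro conjI allI impI; elim conjE)
    fix i j k X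
    assume "i < j" "j < k" "X \<subseteq> {1..n} - {i, j, k}"
      and cube: "{X \<union> {i, k}, X \<union> {j}, X \<union> {i, j}, X \<union> {k}, X \<union> {i}, X \<union> {j, k}} \<subseteq> truncated_cube n m m'"
    then show "?f (X \<union> {i, k}) + ?f (X \<union> {j}) =
        max (?f (X \<union> {i, j}) + ?f (X \<union> {k})) (?f (X \<union> {i}) + ?f (X \<union> {j, k}))"
      by (intro relation[OF cube] flag_plucker_3 fin) auto
  next
    fix i j k l X
    assume "i < j" "j < k" "k < l" "X \<subseteq> {1..n} - {i, j, k, l}"
      and cube: "{X \<union> {i, k}, X \<union> {j, l}, X \<union> {i, j}, X \<union> {k, l}, X \<union> {i, l}, X \<union> {j, k}} \<subseteq> truncated_cube n m m'"
    then show "?f (X \<union> {i, k}) + ?f (X \<union> {j, l}) =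
        max (?f (X \<union> {i, j}) + ?f (X \<union> {k, l})) (?f (X \<union> {i, l}) + ?f (X \<union> {j, k}))"
      by (intro relation[OF cube] flag_plucker_4 fin) auto
  qed
qed

end
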